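(* For any noncrossing partition $\pi$, $$\phi_{\mathcal{NCP}}(\pi)=\sum_{\sim\in\mathcal{E}_c[\pi]}\lambda_{\mathcal{NCP}}(\pi\mid_\cdot\sim)\,\frac{\mathrm{le}(\pi/\!\sim)}{\mathrm{cl}(\sim)!}\,X^{\mathrm{cl}(\sim)}.$$ In particular, the degree of $\phi_{\mathcal{NCP}}(\pi)$ is $|\pi|$, $\lambda_{\mathcal{NCP}}(\pi)$ is the coefficient of $X$ in $\phi_{\mathcal{NCP}}(\pi)$, and $\lambda_0(\pi)$ is the coefficient of $X^{|\pi|}$ in $\phi_{\mathcal{NCP}}(\pi)$.
   Context: $\mathbb{K}$ is a field of characteristic zero. A noncrossing partition is a partition $\pi$ of a set $[n]=\{1,\ldots,n\}$, $n\ge1$, into nonempty blocks such that there are no distinct blocks $b\ne b'$ and $x,z\in b$, $y,t\in b'$ with $x<y<z<t$. $|\pi|$ is its number of blocks; $\mathcal{NCP}$ is the set of all noncrossing partitions. For a nonempty set $Y$ of blocks of $\pi$, $\pi_{\mid Y}$ is the noncrossing partition obtained by deleting the blocks not in $Y$ and renumbering the remaining elements increasingly; $\pi_{\mid\emptyset}=1$. The nesting order on blocks is $b\le_\pi b'\iff b'\subseteq[\min b,\max b]$. $\mathrm{le}(\pi)$ is the number of linear extensions of the poset of blocks $(\pi,\le_\pi)$, i.e. bijections $f:\pi\to[|\pi|]$ with $b\le_\pi b'\Rightarrow f(b)\le f(b')$. An ideal of $\pi$ is a set $J$ of blocks that is upward closed for $\le_\pi$; then the union of its blocks decomposes into maximal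 subsets of consecutive integers $I_1,\ldots,I_k$, each a union of blocks, and $\pi_{\mid_\cdot J}=\prod_i\pi_{\mid I_i}$ (restriction to the blocks contained in $I_i$; product $\cdot$ below). $\mathbb{K}[\mathcal{NCP}]$ is the free commutative algebra generated by $\mathcal{NCP}$, with product $\cdot$ and unit $1$. It carries two coproducts which are algebra morphisms, given on $\pi\in\mathcal{NCP}$ by $\Delta(\pi)=\sum_{J\text{ ideal of }\pi}\pi_{\mid\pi\setminus J}\otimes\pi_{\mid_\cdot J}$ and $\delta(\pi)=\sum_{\sim\in\mathcal{E}_c[\pi]}\pi/\!\sim\,\otimes\,\pi\mid_\cdot\sim$, where, for an equivalence $\sim$ on the set of blocks of $\pi$, $\pi/\!\sim$ is the partition whose blocks are the unions of the blocks in each class, $\mathcal{E}_c[\pi]$ is the set of $\sim$ for which $\pi/\!\sim$ is noncrossing, $\pi\mid_\cdot\sim=\prod_{C\text{ class of }\sim}\pi_{\mid C}$, and $\mathrm{cl}(\sim)$ is the number of classes of $\sim$. The counits are the algebra morphisms with $\varepsilon_\Delta(\pi)=0$, and $\epsilon_\delta(\pi)=1$ if $|\pi|=1$, $\epsilon_\delta(\pi)=0$ otherwise. $\mathbb{K}[X]$ has the multiplicative coproducts $\Delta(X)=X\otimes1+1\otimes X$, $\delta(X)=X\otimes X$ with counits $P\mapsto P(0)$, $P\mapsto P(1)$. $\phi_{\mathcal{NCP}}:\mathbb{K}[\mathcal{NCP}]\to\mathbb{K}[X]$ is the unique algebra morphism compatible with both coproducts $\Delta,\delta$ and both counits. By known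 results it exists, is unique, and for $x\in\ker\varepsilon_\Delta$, $\phi_{\mathcal{NCP}}(x)=\sum_{k\ge1}\epsilon_\delta^{\otimes k}\circ\tilde\Delta^{(k-1)}(x)\,H_k(X)$, with $\tilde\Delta(x)=\Delta(x)-x\otimes1-1\otimes x$, $\tilde\Delta^{(k-1)}$ its iterates ($\tilde\Delta^{(0)}=\mathrm{Id}$), and $H_k(X)=X(X-1)\cdots(X-k+1)/k!$. Characters of $\mathbb{K}[\mathcal{NCP}]$ (algebra morphisms to $\mathbb{K}$) form a monoid under $\lambda\star\mu=(\lambda\otimes\mu)\circ\delta$, with unit $\epsilon_\delta$; a character is invertible for $\star$ if and only if it does not vanish on noncrossing partitions with one block. $\lambda_0$ is the character with $\lambda_0(\pi)=\mathrm{le}(\pi)/|\pi|!$ for $\pi\in\mathcal{NCP}$, and $\lambda_{\mathcal{NCP}}$ is its inverse for $\star$. *)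

theory Defs
  imports
    "HOL-Library.Disjoint_Sets"
    "HOL-Library.FuncSet"
    "HOL-Library.Multiset"
    "HOL-Library.Poly_Mapping"
    "HOL-Library.Product_Plus"
    "HOL-Computational_Algebra.Polynomial"
begin

section \<open>Noncrossing partitions\<close>

definition noncrossing :: "nat set set \<Rightarrow> bool" where
  "noncrossing P \<longleftrightarrow>
     \<not> (\<exists>b\<in>P. \<exists>b'\<in>P. b \<noteq> b' \<and>
          (\<exists>x\<in>b. \<exists>y\<in>b'. \<exists>z\<in>b. \<exists>t\<in>b'. x < y \<and> y < z \<and> z < t))"

typedef ncp = "{P :: nat set set. \<exists>n\<ge>1. partition_on {1..n} P \<and> noncrossing P}"
  morphisms blocks Abs_ncp
proof
  show "{{1}} \<in> {P :: nat set set. \<exists>n\<ge>1. partition_on {1..n} P \<and> noncrossing P}"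
    by (auto simp: noncrossing_def partition_on_def disjoint_def intro!: exI[of _ 1])
qed

definition nest_le :: "nat set \<Rightarrow> nat set \<Rightarrow> bool" where
  "nest_le b b' \<longleftrightarrow> b' \<subseteq> {Min b..Max b}"

text \<open>Functions are extensional outside the set of blocks, so that each linear extension is
  counted exactly once.\<close>

definition linear_extensions :: "ncp \<Rightarrow> (nat set \<Rightarrow> nat) set" where
  "linear_extensions \<pi> =
     {f \<in> blocks \<pi> \<rightarrow>\<^sub>E {1..card (blocks \<pi>)}.
        bij_betw f (blocks \<pi>) {1..card (blocks \<pi>)} \<and>
        (\<forall>b\<in>blocks \<pi>. \<forall>b'\<in>blocks \<pi>. nest_le b b' \<longrightarrow> f b \<le> f b')}"

definition le :: "ncp \<Rightarrow> nat" where
  "le \<pi> = card (linear_extensions \<pi>)"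

definition ideals :: "ncp \<Rightarrow> nat set set set" where
  "ideals \<pi> = {J. J \<subseteq> blocks \<pi> \<and> (\<forall>b\<in>J. \<forall>b'\<in>blocks \<pi>. nest_le b b' \<longrightarrow> b' \<in> J)}"

definition standardize :: "nat set set \<Rightarrow> nat set set" where
  "standardize Y = (\<lambda>b. (\<lambda>x. card {y \<in> \<Union>Y. y \<le> x}) ` b) ` Y"

definition segments :: "nat set \<Rightarrow> nat set set" where
  "segments A =
     {I. I \<noteq> {} \<and> I \<subseteq> A \<and> (\<exists>i j. I = {i..j}) \<and>
         (\<forall>i j. {i..j} \<subseteq> A \<longrightarrow> I \<subseteq> {i..j} \<longrightarrow> {i..j} = I)}"

definition merge :: "ncp \<Rightarrow> (nat set \<times> nat set) set \<Rightarrow> nat set set" where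
  "merge \<pi> r = \<Union> ` (blocks \<pi> // r)"

definition Ec :: "ncp \<Rightarrow> (nat set \<times> nat set) set set" where
  "Ec \<pi> = {r. equiv (blocks \<pi>) r \<and> noncrossing (merge \<pi> r)}"

definition quotient_ncp :: "ncp \<Rightarrow> (nat set \<times> nat set) set \<Rightarrow> ncp" where
  "quotient_ncp \<pi> r = Abs_ncp (merge \<pi> r)"

definition cl :: "ncp \<Rightarrow> (nat set \<times> nat set) set \<Rightarrow> nat" where
  "cl \<pi> r = card (blocks \<pi> // r)"

text \<open>The two constructions above stay inside \<^typ>\<open>ncp\<close>, so that \<^const>\<open>Abs_ncp\<close>
  is only ever applied to noncrossing partitions.\<close>

lemma merge_ncp:
  assumes "r \<in> Ec \<pi>"
  shows "blocks (quotient_ncp \<pi> r) = merge \<pi> r"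
proof -
  have eq: "equiv (blocks \<pi>) r" and nc: "noncrossing (merge \<pi> r)"
    using assms by (auto simp: Ec_def)
  obtain n where n: "n \<ge> 1" "partition_on {1..n} (blocks \<pi>)"
    using blocks[of \<pi>] by auto
  have q: "partition_on (blocks \<pi>) (blocks \<pi> // r)"
    by (rule partition_on_quotient[OF eq])
  have "partition_on {1..n} (merge \<pi> r)"
  proof (rule partition_onI)
    show "\<Union> (merge \<pi> r) = {1..n}"
      using Union_quotient[OF eq] unfolding partition_onD1[OF n(2)] merge_def by blast
    have "p \<noteq> {}" if p: "p \<in> merge \<pi> r" for p
    proof -
      obtain C where C: "C \<in> blocks \<pi> // r" "p = \<Union>C" using p unfolding merge_def by blast
      have "C \<noteq> {}" using C(1) partition_onD3[OF q] by blast
      moreover have "C \<subseteq> blocks \<pi>" using C(1) Union_quotient[OF eq] by blast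
      ultimately obtain b where "b \<in> C" "b \<noteq> {}"
        using partition_onD3[OF n(2)] by (metis all_not_in_conv subsetD)
      then show ?thesis unfolding C(2) by blast
    qed
    then show "{} \<notin> merge \<pi> r" by blast
    show "disjnt p p'" if p: "p \<in> merge \<pi> r" "p' \<in> merge \<pi> r" "p \<noteq> p'" for p p'
    proof -
      obtain C where C: "C \<in> blocks \<pi> // r" "p = \<Union>C" using p(1) unfolding merge_def by blast
      obtain D where D: "D \<in> blocks \<pi> // r" "p' = \<Union>D" using p(2) unfolding merge_def by blast
      have CD: "C \<inter> D = {}" using quotient_disj[OF eq C(1) D(1)] C(2) D(2) p(3) by blast
      have sub: "C \<subseteq> blocks \<pi>" "D \<subseteq> blocks \<pi>"
        using C(1) D(1) Union_quotient[OF eq] by blast+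
      have "b \<inter> b' = {}" if "b \<in> C" "b' \<in> D" for b b'
        by (rule disjointD[OF partition_onD2[OF n(2)]]) (use that CD sub in blast)+
      then show ?thesis unfolding disjnt_def C(2) D(2) by blast
    qed
  qed
  then show ?thesis
    using n nc unfolding quotient_ncp_def by (intro Abs_ncp_inverse) auto
qed

lemma standardize_ncp:
  assumes Y: "Y \<subseteq> blocks \<pi>" "Y \<noteq> {}"
  shows "blocks (Abs_ncp (standardize Y)) = standardize Y"
proof -
  obtain n where n: "partition_on {1..n} (blocks \<pi>)" and nc: "noncrossing (blocks \<pi>)"
    using blocks[of \<pi>] by auto
  define A where "A = \<Union>Y"
  define \<rho> where "\<rho> x = card {y \<in> A. y \<le> x}" for x
  have YA: "partition_on A Y"
    unfolding A_def
  proof (rule partition_onI)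
    show "disjnt p p'" if "p \<in> Y" "p' \<in> Y" "p \<noteq> p'" for p p'
      using disjointD[OF partition_onD2[OF n], of p p'] that Y(1) by (auto simp: disjnt_def)
    show "{} \<notin> Y" using partition_onD3[OF n] Y(1) by auto
  qed simp
  have "A \<subseteq> {1..n}" unfolding A_def partition_onD1[OF n] by (rule Union_mono[OF Y(1)])
  then have fin: "finite A" by (rule finite_subset) simp
  obtain b where "b \<in> Y" "b \<noteq> {}" using Y(2) partition_onD3[OF YA] by (metis all_not_in_conv)
  then have "A \<noteq> {}" unfolding A_def by blast
  then have card1: "card A \<ge> 1" using fin by (simp add: Suc_le_eq card_gt_0_iff)
  have mono: "\<rho> x < \<rho> y" if "x < y" "y \<in> A" for x y
  proof -
    have "y \<in> {z \<in> A. z \<le> y}" "y \<notin> {z \<in> A. z \<le> x}" using that by auto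
    moreover have "{z \<in> A. z \<le> x} \<subseteq> {z \<in> A. z \<le> y}" using that by auto
    ultimately show ?thesis unfolding \<rho>_def using fin by (intro psubset_card_mono) (simp, blast)
  qed
  have less: "x < y" if "\<rho> x < \<rho> y" "x \<in> A" for x y
    using mono[of y x] that by (metis linorder_cases order_less_asym order_less_irrefl)
  have inj: "inj_on \<rho> A"
    by (intro linorder_inj_onI) (use mono in \<open>auto simp: less_imp_neq\<close>)
  have "\<rho> ` A \<subseteq> {1..card A}"
  proof
    fix k assume "k \<in> \<rho> ` A"
    then obtain x where x: "x \<in> A" "k = \<rho> x" by auto
    have "{y \<in> A. y \<le> x} \<noteq> {}" using x by auto
    then have "\<rho> x > 0" using fin by (simp add: \<rho>_def card_gt_0_iff)
    moreover have "\<rho> x \<le> card A" unfolding \<rho>_def using fin by (intro card_mono) auto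
    ultimately show "k \<in> {1..card A}" using x by auto
  qed
  then have img: "\<rho> ` A = {1..card A}"
    by (intro card_subset_eq) (auto simp: card_image[OF inj])
  have st: "standardize Y = (`) \<rho> ` Y"
    by (simp add: standardize_def \<rho>_def[abs_def] A_def)
  have sub: "b \<subseteq> A" if "b \<in> Y" for b using that by (auto simp: A_def)
  have "partition_on {1..card A} (standardize Y)"
  proof (rule partition_onI)
    show "\<Union> (standardize Y) = {1..card A}"
      unfolding st img[symmetric] by (auto simp: A_def)
    show "{} \<notin> standardize Y" using partition_onD3[OF YA] by (auto simp: st)
    show "disjnt p q" if pq: "p \<in> standardize Y" "q \<in> standardize Y" "p \<noteq> q" for p q
    proof -
      obtain b c where bc: "b \<in> Y" "c \<in> Y" "p = \<rho> ` b" "q = \<rho> ` c"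
        using pq by (auto simp: st)
      have "b \<inter> c = {}"
        by (rule disjointD[OF partition_onD2[OF YA] bc(1,2)]) (use bc(3,4) pq(3) in auto)
      then have "\<rho> ` b \<inter> \<rho> ` c = {}"
        using inj_on_image_Int[OF inj sub[OF bc(1)] sub[OF bc(2)]] by simp
      then show ?thesis by (simp add: disjnt_def bc)
    qed
  qed
  moreover have "noncrossing (standardize Y)"
  proof (rule ccontr)
    assume "\<not> noncrossing (standardize Y)"
    then obtain b c x y z t where h: "b \<in> Y" "c \<in> Y" "\<rho> ` b \<noteq> \<rho> ` c"
      "x \<in> b" "y \<in> c" "z \<in> b" "t \<in> c" "\<rho> x < \<rho> y" "\<rho> y < \<rho> z" "\<rho> z < \<rho> t"
      unfolding noncrossing_def st by blast
    have lt: "x < y" "y < z" "z < t"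
      using less[OF h(8)] less[OF h(9)] less[OF h(10)] h(4-6) sub[OF h(1)] sub[OF h(2)] by blast+
    have bc: "b \<in> blocks \<pi>" "c \<in> blocks \<pi>" "b \<noteq> c" using h(1-3) Y(1) by auto
    have "\<exists>x\<in>b. \<exists>y\<in>c. \<exists>z\<in>b. \<exists>t\<in>c. x < y \<and> y < z \<and> z < t"
      by (intro bexI conjI) (fact lt h)+
    then have "\<not> noncrossing (blocks \<pi>)"
      unfolding noncrossing_def not_not using bc by (intro bexI[of _ b] bexI[of _ c] conjI)
    then show False using nc by contradiction
  qed
  ultimately show ?thesis using card1 by (intro Abs_ncp_inverse) auto
qed


section \<open>The free commutative algebra on noncrossing partitions\<close>

text \<open>The algebra is the monoid algebra of the free commutative monoid on noncrossing
  partitions, whose elements are the finite multisets. For monoids \<open>M\<close> and \<open>N\<close>, the tensor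
  product of their monoid algebras is the monoid algebra of \<open>M \<times> N\<close>.\<close>

type_synonym 'k ncp_alg = "ncp multiset \<Rightarrow>\<^sub>0 'k"
type_synonym 'k ncp_alg2 = "ncp multiset \<times> ncp multiset \<Rightarrow>\<^sub>0 'k"

definition gen :: "ncp \<Rightarrow> 'k::field_char_0 ncp_alg" where
  "gen \<pi> = Poly_Mapping.single {#\<pi>#} 1"

definition tensor :: "'k::field_char_0 ncp_alg \<Rightarrow> 'k ncp_alg \<Rightarrow> 'k ncp_alg2" where
  "tensor x y = (\<Sum>m\<in>Poly_Mapping.keys x. \<Sum>n\<in>Poly_Mapping.keys y.
     Poly_Mapping.single (m, n) (Poly_Mapping.lookup x m * Poly_Mapping.lookup y n))"

text \<open>Commutative algebras over \<open>'k\<close> are given by their structure maps \<open>\<iota>\<close> from \<open>'k\<close>; preserving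
  structure maps amounts to being unital and \<open>'k\<close>-linear.\<close>

definition alg_morphism ::
  "('k::field_char_0 \<Rightarrow> 'a::comm_ring_1) \<Rightarrow> ('k \<Rightarrow> 'b::comm_ring_1) \<Rightarrow> ('a \<Rightarrow> 'b) \<Rightarrow> bool" where
  "alg_morphism \<iota> \<iota>' h \<longleftrightarrow>
     (\<forall>x y. h (x + y) = h x + h y) \<and> (\<forall>x y. h (x * y) = h x * h y) \<and> (\<forall>c. h (\<iota> c) = \<iota>' c)"

text \<open>The algebra morphism to the algebra with structure map \<open>\<iota>\<close> which extends \<open>f\<close>.\<close>

definition alg_extend ::
  "('k::field_char_0 \<Rightarrow> 'a::comm_ring_1) \<Rightarrow> (ncp \<Rightarrow> 'a) \<Rightarrow> 'k ncp_alg \<Rightarrow> 'a" where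
  "alg_extend \<iota> f x =
     (\<Sum>m\<in>Poly_Mapping.keys x. \<iota> (Poly_Mapping.lookup x m) * (\<Prod>\<pi>\<in>#m. f \<pi>))"

text \<open>The linear map \<open>f \<otimes> g\<close> for linear \<open>f\<close> and \<open>g\<close>; here \<open>T\<close> is the bilinear map
  \<open>(a, b) \<mapsto> a \<otimes> b\<close> and \<open>\<iota>\<close> the structure map of the target.\<close>

definition tensor_map ::
  "('k::field_char_0 \<Rightarrow> 'c::comm_ring_1) \<Rightarrow> ('a \<Rightarrow> 'b \<Rightarrow> 'c) \<Rightarrow>
   ('k ncp_alg \<Rightarrow> 'a) \<Rightarrow> ('k ncp_alg \<Rightarrow> 'b) \<Rightarrow> 'k ncp_alg2 \<Rightarrow> 'c" where
  "tensor_map \<iota> T f g z =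
     (\<Sum>(m, n)\<in>Poly_Mapping.keys z. \<iota> (Poly_Mapping.lookup z (m, n)) *
        T (f (Poly_Mapping.single m 1)) (g (Poly_Mapping.single n 1)))"

text \<open>\<open>restr Y\<close> is the restriction \<open>\<pi>\<^bsub>|Y\<^esub>\<close>, for \<open>Y\<close> a set of blocks of \<open>\<pi>\<close>.\<close>

definition restr :: "nat set set \<Rightarrow> 'k::field_char_0 ncp_alg" where
  "restr Y = (if Y = {} then 1 else gen (Abs_ncp (standardize Y)))"

text \<open>For an ideal \<open>J\<close> of \<open>\<pi>\<close>, every segment of \<open>\<Union>J\<close> is a union of blocks of \<open>\<pi>\<close>.\<close>

definition restr_ideal :: "nat set set \<Rightarrow> 'k::field_char_0 ncp_alg" where
  "restr_ideal J = (\<Prod>I\<in>segments (\<Union>J). restr {b \<in> J. b \<subseteq> I})"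

definition restr_equiv :: "ncp \<Rightarrow> (nat set \<times> nat set) set \<Rightarrow> 'k::field_char_0 ncp_alg" where
  "restr_equiv \<pi> r = (\<Prod>C\<in>blocks \<pi> // r. restr C)"

definition Delta :: "'k::field_char_0 ncp_alg \<Rightarrow> 'k ncp_alg2" where
  "Delta = alg_extend (Poly_Mapping.single 0)
     (\<lambda>\<pi>. \<Sum>J\<in>ideals \<pi>. tensor (restr (blocks \<pi> - J)) (restr_ideal J))"

definition delta :: "'k::field_char_0 ncp_alg \<Rightarrow> 'k ncp_alg2" where
  "delta = alg_extend (Poly_Mapping.single 0)
     (\<lambda>\<pi>. \<Sum>r\<in>Ec \<pi>. tensor (gen (quotient_ncp \<pi> r)) (restr_equiv \<pi> r))"

definition eps_Delta :: "'k::field_char_0 ncp_alg \<Rightarrow> 'k" where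
  "eps_Delta = alg_extend (\<lambda>c. c) (\<lambda>\<pi>. 0)"

definition eps_delta :: "'k::field_char_0 ncp_alg \<Rightarrow> 'k" where
  "eps_delta = alg_extend (\<lambda>c. c) (\<lambda>\<pi>. if card (blocks \<pi>) = 1 then 1 else 0)"


section \<open>The polynomial double bialgebra and the morphism to it\<close>

text \<open>The tensor square of \<open>'k poly\<close> is \<open>'k poly poly\<close>, where \<open>X \<otimes> 1\<close> is the inner and
  \<open>1 \<otimes> X\<close> the outer variable.\<close>

definition poly_tensor :: "'k::field_char_0 poly \<Rightarrow> 'k poly \<Rightarrow> 'k poly poly" where
  "poly_tensor P Q = [:P:] * map_poly (\<lambda>c. [:c:]) Q"

definition Delta_poly :: "'k::field_char_0 poly \<Rightarrow> 'k poly poly" where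
  "Delta_poly P =
     poly (map_poly (\<lambda>c. [:[:c:]:]) P) (poly_tensor [:0, 1:] 1 + poly_tensor 1 [:0, 1:])"

definition delta_poly :: "'k::field_char_0 poly \<Rightarrow> 'k poly poly" where
  "delta_poly P = poly (map_poly (\<lambda>c. [:[:c:]:]) P) (poly_tensor [:0, 1:] [:0, 1:])"

definition double_bialgebra_morphism :: "('k::field_char_0 ncp_alg \<Rightarrow> 'k poly) \<Rightarrow> bool" where
  "double_bialgebra_morphism \<phi> \<longleftrightarrow>
     alg_morphism (Poly_Mapping.single 0) (\<lambda>c. [:c:]) \<phi> \<and>
     (\<forall>x. Delta_poly (\<phi> x) = tensor_map (\<lambda>c. [:[:c:]:]) poly_tensor \<phi> \<phi> (Delta x)) \<and>
     (\<forall>x. delta_poly (\<phi> x) = tensor_map (\<lambda>c. [:[:c:]:]) poly_tensor \<phi> \<phi> (delta x)) \<and>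
     (\<forall>x. poly (\<phi> x) 0 = eps_Delta x) \<and>
     (\<forall>x. poly (\<phi> x) 1 = eps_delta x)"

definition phi_NCP :: "'k::field_char_0 ncp_alg \<Rightarrow> 'k poly" where
  "phi_NCP = (THE \<phi>. double_bialgebra_morphism \<phi>)"


section \<open>Characters\<close>

definition character :: "('k::field_char_0 ncp_alg \<Rightarrow> 'k) \<Rightarrow> bool" where
  "character \<chi> \<longleftrightarrow> alg_morphism (Poly_Mapping.single 0) (\<lambda>c. c) \<chi>"

definition star ::
  "('k::field_char_0 ncp_alg \<Rightarrow> 'k) \<Rightarrow> ('k ncp_alg \<Rightarrow> 'k) \<Rightarrow> 'k ncp_alg \<Rightarrow> 'k" where
  "star \<chi> \<mu> x = tensor_map (\<lambda>c. c) (*) \<chi> \<mu> (delta x)"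

definition lambda_0 :: "'k::field_char_0 ncp_alg \<Rightarrow> 'k" where
  "lambda_0 = alg_extend (\<lambda>c. c) (\<lambda>\<pi>. of_nat (le \<pi>) / fact (card (blocks \<pi>)))"

definition lambda_NCP :: "'k::field_char_0 ncp_alg \<Rightarrow> 'k" where
  "lambda_NCP =
     (THE \<mu>. character \<mu> \<and> star lambda_0 \<mu> = eps_delta \<and> star \<mu> lambda_0 = eps_delta)"

end

theory Submission
  imports Defs
begin

text \<open>For functions \<open>f\<close>, \<open>g\<close> on noncrossing partitions let \<open>conv_fn f g\<close> and \<open>star_fn f g\<close> be the functions
whose multiplicative extensions are the products, induced by \<open>\<Delta>\<close> and by \<open>\<delta>\<close>, of the characters
extending \<open>f\<close> and \<open>g\<close>. Two combinatorial facts carry the proof.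

\<^item> \<open>star_distributes_over_conv\<close>: \<open>(f * g) \<star> h = (f \<star> h) * (g \<star> h)\<close>. Contracting \<open>\<pi>\<close> and then choosing
  an ideal of the result amounts to choosing an ideal of \<open>\<pi>\<close> and contracting separately its complement
  and each of its segments.
\<^item> \<open>conv_lam0_scaled\<close>: the functions \<open>\<pi> \<mapsto> \<lambda>\<^sub>0(\<pi>) x\<^bsup>|\<pi>|\<^esup>\<close> satisfy \<open>f\<^sub>x * f\<^sub>y = f\<^bsub>x+y\<^esub>\<close>. This is a
  binomial theorem for the numbers \<open>|linear extensions of S| / |S|!\<close>, which are multiplicative over
  unrelated pieces.

Triangularity gives a function \<open>\<lambda>\<close> with \<open>\<lambda>\<^sub>0 \<star> \<lambda> = \<epsilon>\<^sub>\<delta>\<close>. Let \<open>p\<^sub>x = f\<^sub>x \<star> \<lambda>\<close>. For fixed \<open>\<pi>\<close> this is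
the value at \<open>x\<close> of the polynomial on the right-hand side of the theorem. The two facts give
\<open>p\<^sub>x * p\<^sub>y = p\<^bsub>x+y\<^esub>\<close>, and \<open>p\<^sub>1 = \<epsilon>\<^sub>\<delta>\<close> by the choice of \<open>\<lambda>\<close>. Distributivity, applied to
\<open>p\<^sub>n = p\<^sub>1 * \<dots> * p\<^sub>1\<close>, then gives \<open>p\<^sub>n \<star> p\<^sub>y = p\<^bsub>ny\<^esub>\<close>. As polynomials are determined by their values at
natural numbers, the multiplicative extension of \<open>p\<close> respects both coproducts. Conversely a double
bialgebra morphism takes at \<open>n + 1\<close> the values dictated by those at \<open>n\<close> and at \<open>1\<close>, so
\<open>\<phi>\<^bsub>NCP\<^esub>\<close> is this extension.

The coefficients are read off: the total contraction is the only one with one class and contributes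
\<open>\<lambda>(\<pi>) X\<close>, the trivial one is the only one with \<open>|\<pi>|\<close> classes and contributes \<open>\<lambda>\<^sub>0(\<pi>) X\<^bsup>|\<pi>|\<^esup>\<close>. Finally
\<open>\<lambda>\<close> is a two-sided inverse of \<open>\<lambda>\<^sub>0\<close>: the coefficients of \<open>X Y\<^bsup>|\<pi>|\<^esup>\<close> in
\<open>p\<^bsub>XY\<^esub> = p\<^sub>X \<star> p\<^sub>Y\<close> give \<open>\<lambda> \<star> \<lambda>\<^sub>0 = \<epsilon>\<^sub>\<delta>\<close>.\<close>

section \<open>Algebra morphisms out of a monoid algebra\<close>

text \<open>The maps \<^const>\<open>alg_extend\<close> and \<^const>\<open>tensor_map\<close> are both linear extensions of a function on a
monoid, to the monoid algebra over \<open>ncp multiset\<close> and over its square. Treating them as one map makes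
their multiplicativity a single lemma.\<close>

definition mon_ext ::
  "('k::field_char_0 \<Rightarrow> 'c::comm_ring_1) \<Rightarrow> ('m \<Rightarrow> 'c) \<Rightarrow> ('m \<Rightarrow>\<^sub>0 'k) \<Rightarrow> 'c" where
  "mon_ext \<iota> F z = (\<Sum>k\<in>Poly_Mapping.keys z. \<iota> (Poly_Mapping.lookup z k) * F k)"

text \<open>Ring homomorphisms, the property that makes \<open>\<iota>\<close> the structure map of a \<open>'k\<close>-algebra.\<close>

definition structure_map :: "('k::field_char_0 \<Rightarrow> 'c::comm_ring_1) \<Rightarrow> bool" where
  "structure_map \<iota> \<longleftrightarrow> \<iota> 1 = 1 \<and> (\<forall>a b. \<iota> (a + b) = \<iota> a + \<iota> b) \<and> (\<forall>a b. \<iota> (a * b) = \<iota> a * \<iota> b)"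

lemma structure_mapD:
  assumes "structure_map \<iota>"
  shows "\<iota> 1 = 1" "\<iota> (a + b) = \<iota> a + \<iota> b" "\<iota> (a * b) = \<iota> a * \<iota> b" "\<iota> 0 = 0"
proof -
  show *: "\<iota> 1 = 1" "\<iota> (a + b) = \<iota> a + \<iota> b" "\<iota> (a * b) = \<iota> a * \<iota> b" for a b
    using assms by (auto simp: structure_map_def)
  show "\<iota> 0 = 0" using *(2)[of 0 0] by simp
qed

lemma structure_map_id: "structure_map (\<lambda>c. c)"
  and structure_map_poly: "structure_map (\<lambda>c. [:c:])"
  and structure_map_single: "structure_map (Poly_Mapping.single (0 :: 'm::comm_monoid_add))"
  by (auto simp: structure_map_def single_add mult_single)

lemma mon_ext_superset:
  assumes "structure_map \<iota>" "finite A" "Poly_Mapping.keys z \<subseteq> A"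
  shows "mon_ext \<iota> F z = (\<Sum>k\<in>A. \<iota> (Poly_Mapping.lookup z k) * F k)"
  unfolding mon_ext_def
  by (rule sum.mono_neutral_left)
    (use assms in \<open>auto simp: in_keys_iff structure_mapD(4)\<close>)

lemma mon_ext_add:
  assumes "structure_map \<iota>"
  shows "mon_ext \<iota> F (x + y) = mon_ext \<iota> F x + mon_ext \<iota> F y"
proof -
  let ?A = "Poly_Mapping.keys x \<union> Poly_Mapping.keys y"
  have "Poly_Mapping.keys (x + y) \<subseteq> ?A" by (rule Poly_Mapping.keys_add)
  then show ?thesis
    by (simp add: mon_ext_superset[OF assms, of ?A] lookup_add structure_mapD[OF assms]
        algebra_simps sum.distrib)
qed

lemma mon_ext_single:
  assumes "structure_map \<iota>"
  shows "mon_ext \<iota> F (Poly_Mapping.single k c) = \<iota> c * F k"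
  by (simp add: mon_ext_def structure_mapD(4)[OF assms])

lemma mon_ext_zero: "structure_map \<iota> \<Longrightarrow> mon_ext \<iota> F 0 = 0"
  by (simp add: mon_ext_def)

lemma mon_ext_sum:
  assumes "structure_map \<iota>"
  shows "mon_ext \<iota> F (\<Sum>i\<in>I. x i) = (\<Sum>i\<in>I. mon_ext \<iota> F (x i))"
  by (induction I rule: infinite_finite_induct) (auto simp: mon_ext_zero[OF assms] mon_ext_add[OF assms])

lemma poly_mapping_single_induct [case_names zero single add]:
  fixes z :: "'m \<Rightarrow>\<^sub>0 'k::field_char_0"
  assumes "P 0" "\<And>k c. P (Poly_Mapping.single k c)" "\<And>x y. P x \<Longrightarrow> P y \<Longrightarrow> P (x + y)"
  shows "P z"
proof (induction z rule: update_induct)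
  case const then show ?case using assms(1) by simp
next
  case (update f a b)
  have "Poly_Mapping.update a b f = f + Poly_Mapping.single a b"
    using update(1) by (intro poly_mapping_eqI) (auto simp: lookup_update lookup_add lookup_single in_keys_iff when_def)
  then show ?case using assms(2,3) update by simp
qed

lemma mon_ext_mult:
  fixes F :: "'m::comm_monoid_add \<Rightarrow> 'c::comm_ring_1"
  assumes \<iota>: "structure_map \<iota>" and F: "\<And>k l. F (k + l) = F k * F l"
  shows "mon_ext \<iota> F (x * y) = mon_ext \<iota> F x * mon_ext \<iota> F y"
proof (induction x rule: poly_mapping_single_induct)
  case zero then show ?case by (simp add: mon_ext_zero[OF \<iota>])
next
  case (single k c)
  show ?case
  proof (induction y rule: poly_mapping_single_induct)
    case zero then show ?case by (simp add: mon_ext_zero[OF \<iota>])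
  next
    case (single l d)
    show ?case by (simp add: mult_single mon_ext_single[OF \<iota>] F structure_mapD[OF \<iota>] algebra_simps)
  next
    case (add x y) then show ?case by (simp add: distrib_left mon_ext_add[OF \<iota>])
  qed
next
  case (add x y) then show ?case by (simp add: distrib_right mon_ext_add[OF \<iota>])
qed

lemma alg_extend_eq_mon_ext: "alg_extend \<iota> f = mon_ext \<iota> (\<lambda>m. \<Prod>\<pi>\<in>#m. f \<pi>)"
  by (rule ext) (simp add: alg_extend_def mon_ext_def)

lemma tensor_map_eq_mon_ext:
  "tensor_map \<iota> T f g =
     mon_ext \<iota> (\<lambda>(m, n). T (f (Poly_Mapping.single m 1)) (g (Poly_Mapping.single n 1)))"
  by (rule ext) (auto simp: tensor_map_def mon_ext_def intro!: sum.cong)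

lemma alg_extend_alg_morphism:
  assumes "structure_map \<iota>"
  shows "alg_morphism (Poly_Mapping.single 0) \<iota> (alg_extend \<iota> f)"
  unfolding alg_morphism_def alg_extend_eq_mon_ext
  by (simp add: mon_ext_add[OF assms] mon_ext_mult[OF assms] mon_ext_single[OF assms])

lemma alg_extend_gen: "structure_map \<iota> \<Longrightarrow> alg_extend \<iota> f (gen \<pi>) = f \<pi>"
  by (simp add: alg_extend_eq_mon_ext gen_def mon_ext_single structure_mapD)

text \<open>The generators \<^term>\<open>gen \<pi>\<close> and the scalars generate the algebra. All comparisons of characters below
reduce to generators by this rule.\<close>

lemma alg_morphism_eqI:
  fixes h h' :: "'k::field_char_0 ncp_alg \<Rightarrow> 'c::comm_ring_1"
  assumes h: "alg_morphism (Poly_Mapping.single 0) \<iota> h"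
    and h': "alg_morphism (Poly_Mapping.single 0) \<iota> h'"
    and eq: "\<And>\<pi>. h (gen \<pi>) = h' (gen \<pi>)"
  shows "h = h'"
proof
  have one: "h (Poly_Mapping.single m 1) = h' (Poly_Mapping.single m 1)" for m
  proof (induction m)
    case empty
    show ?case using h h' unfolding alg_morphism_def by (metis zero_multiset_def)
  next
    case (add \<pi> m)
    have "Poly_Mapping.single (add_mset \<pi> m) (1::'k) = gen \<pi> * Poly_Mapping.single m 1"
      by (simp add: gen_def mult_single)
    then show ?case using h h' eq add by (simp add: alg_morphism_def)
  qed
  show "h x = h' x" for x
  proof (induction x rule: poly_mapping_single_induct)
    case zero
    have "h 0 + h 0 = h 0" "h' 0 + h' 0 = h' 0"
      using h h' unfolding alg_morphism_def by (metis add.right_neutral)+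
    then show ?case by simp
  next
    case (single m c)
    have "Poly_Mapping.single m c = Poly_Mapping.single 0 c * Poly_Mapping.single m 1"
      by (simp add: mult_single)
    then show ?case using h h' one by (simp add: alg_morphism_def)
  next
    case (add x y)
    then show ?case using h h' by (simp add: alg_morphism_def)
  qed
qed

abbreviation char_ext :: "(ncp \<Rightarrow> 'k::field_char_0) \<Rightarrow> 'k ncp_alg \<Rightarrow> 'k" where
  "char_ext \<equiv> alg_extend (\<lambda>c. c)"

lemma character_char_ext: "character (char_ext f)"
  unfolding character_def by (rule alg_extend_alg_morphism[OF structure_map_id])

lemma char_ext_gen: "char_ext f (gen \<pi>) = f \<pi>"
  by (rule alg_extend_gen[OF structure_map_id])

lemma character_eq_char_ext:
  assumes "character \<chi>"
  shows "\<chi> = char_ext (\<lambda>\<pi>. \<chi> (gen \<pi>))"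
  by (rule alg_morphism_eqI[OF assms[unfolded character_def]
        character_char_ext[unfolded character_def]]) (simp add: char_ext_gen)

lemma alg_morphism_one: "alg_morphism (Poly_Mapping.single 0) \<iota> h \<Longrightarrow> \<iota> 1 = 1 \<Longrightarrow> h 1 = 1"
  unfolding alg_morphism_def by (metis single_one)

lemma alg_morphism_prod:
  assumes "alg_morphism (Poly_Mapping.single 0) \<iota> h" "\<iota> 1 = 1"
  shows "h (\<Prod>i\<in>I. x i) = (\<Prod>i\<in>I. h (x i))"
  using alg_morphism_one[OF assms] assms(1)
  by (induction I rule: infinite_finite_induct) (auto simp: alg_morphism_def)

lemma tensor_map_tensor:
  "tensor_map (\<lambda>c. c) (*) (char_ext f) (char_ext g) (tensor x y) = char_ext f x * char_ext g y"
proof -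
  let ?F = "\<lambda>m. \<Prod>\<pi>\<in>#m. f \<pi>" and ?G = "\<lambda>m. \<Prod>\<pi>\<in>#m. g \<pi>"
  have "tensor_map (\<lambda>c. c) (*) (char_ext f) (char_ext g) (tensor x y) =
     (\<Sum>m\<in>Poly_Mapping.keys x. \<Sum>n\<in>Poly_Mapping.keys y.
        (Poly_Mapping.lookup x m * Poly_Mapping.lookup y n) * (?F m * ?G n))"
    by (simp add: tensor_map_eq_mon_ext tensor_def mon_ext_sum mon_ext_single structure_map_id
        alg_extend_eq_mon_ext)
  also have "\<dots> = char_ext f x * char_ext g y"
    by (simp add: alg_extend_eq_mon_ext mon_ext_def sum_product algebra_simps)
  finally show ?thesis .
qed

text \<open>Both sides are algebra morphisms which agree on generators. Applied to \<^const>\<open>Delta\<close> and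
\<^const>\<open>delta\<close>, this shows that the two products of characters are characters, and it reduces them to
operations on functions on noncrossing partitions.\<close>

lemma tensor_map_coproduct:
  fixes D :: "ncp \<Rightarrow> 'k::field_char_0 ncp_alg2"
  shows "(\<lambda>x. tensor_map (\<lambda>c. c) (*) (char_ext f) (char_ext g) (alg_extend (Poly_Mapping.single 0) D x))
    = char_ext (\<lambda>\<pi>. tensor_map (\<lambda>c. c) (*) (char_ext f) (char_ext g) (D \<pi>))"
proof (rule alg_morphism_eqI[where \<iota> = "\<lambda>c. c"])
  let ?F = "\<lambda>(m, n). char_ext f (Poly_Mapping.single m 1) * char_ext g (Poly_Mapping.single n 1)"
  have F: "?F (k + l) = ?F k * ?F l" for k l
    by (cases k; cases l) (simp add: alg_extend_eq_mon_ext mon_ext_single structure_map_id)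
  have F0: "?F 0 = 1"
    by (simp add: alg_extend_eq_mon_ext mon_ext_single structure_map_id zero_prod_def)
  show "alg_morphism (Poly_Mapping.single 0) (\<lambda>c. c)
     (\<lambda>x. tensor_map (\<lambda>c. c) (*) (char_ext f) (char_ext g) (alg_extend (Poly_Mapping.single 0) D x))"
    using alg_extend_alg_morphism[OF structure_map_single, of D] F0
    by (simp add: alg_morphism_def tensor_map_eq_mon_ext mon_ext_add mon_ext_mult[OF _ F]
        structure_map_id mon_ext_single)
  show "alg_morphism (Poly_Mapping.single 0) (\<lambda>c. c)
     (char_ext (\<lambda>\<pi>. tensor_map (\<lambda>c. c) (*) (char_ext f) (char_ext g) (D \<pi>)))"
    by (rule alg_extend_alg_morphism[OF structure_map_id])
qed (simp add: alg_extend_gen structure_map_id structure_map_single)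

definition standard :: "nat set set \<Rightarrow> ncp" where
  "standard Y = Abs_ncp (standardize Y)"

text \<open>The value of the character extending \<open>f\<close> on the restriction to the blocks in \<open>Y\<close>. The convention for
the empty set is that of \<^const>\<open>restr\<close>.\<close>

definition hat :: "(ncp \<Rightarrow> 'k::field_char_0) \<Rightarrow> nat set set \<Rightarrow> 'k" where
  "hat f Y = (if Y = {} then 1 else f (standard Y))"

lemma char_ext_restr: "char_ext f (restr Y) = hat f Y"
  using alg_morphism_one[OF alg_extend_alg_morphism[OF structure_map_id], of f]
  by (simp add: hat_def restr_def standard_def char_ext_gen)

lemma char_ext_prod: "char_ext f (\<Prod>i\<in>I. x i) = (\<Prod>i\<in>I. char_ext f (x i))"
  by (rule alg_morphism_prod[OF alg_extend_alg_morphism[OF structure_map_id]]) simp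

text \<open>The product of characters dual to \<^const>\<open>Delta\<close>, on generators.\<close>

definition conv_fn :: "(ncp \<Rightarrow> 'k::field_char_0) \<Rightarrow> (ncp \<Rightarrow> 'k) \<Rightarrow> ncp \<Rightarrow> 'k" where
  "conv_fn f g \<pi> = (\<Sum>J\<in>ideals \<pi>. hat f (blocks \<pi> - J) *
     (\<Prod>I\<in>segments (\<Union>J). hat g {b \<in> J. b \<subseteq> I}))"

lemma conv_char_ext:
  "tensor_map (\<lambda>c. c) (*) (char_ext f) (char_ext g) (Delta x) = char_ext (conv_fn f g) x"
proof -
  have "tensor_map (\<lambda>c. c) (*) (char_ext f) (char_ext g)
     (\<Sum>J\<in>ideals \<pi>. tensor (restr (blocks \<pi> - J)) (restr_ideal J)) = conv_fn f g \<pi>" for \<pi>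
    unfolding tensor_map_eq_mon_ext mon_ext_sum[OF structure_map_id]
    unfolding tensor_map_eq_mon_ext[symmetric] tensor_map_tensor char_ext_restr restr_ideal_def char_ext_prod conv_fn_def ..
  then show ?thesis
    using fun_cong[OF tensor_map_coproduct, of f g _ x] by (simp add: Delta_def)
qed

lemma star_char_ext_Ec:
  "star (char_ext f) (char_ext g) =
     char_ext (\<lambda>\<pi>. \<Sum>r\<in>Ec \<pi>. f (quotient_ncp \<pi> r) * (\<Prod>C\<in>blocks \<pi> // r. hat g C))"
proof -
  have "tensor_map (\<lambda>c. c) (*) (char_ext f) (char_ext g)
     (\<Sum>r\<in>Ec \<pi>. tensor (gen (quotient_ncp \<pi> r)) (restr_equiv \<pi> r)) =
     (\<Sum>r\<in>Ec \<pi>. f (quotient_ncp \<pi> r) * (\<Prod>C\<in>blocks \<pi> // r. hat g C))" for \<pi>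
    unfolding tensor_map_eq_mon_ext mon_ext_sum[OF structure_map_id]
    unfolding tensor_map_eq_mon_ext[symmetric] tensor_map_tensor char_ext_gen char_ext_restr restr_equiv_def char_ext_prod ..
  then show ?thesis
    using tensor_map_coproduct[of f g] by (simp add: star_def[abs_def] delta_def)
qed

section \<open>Blocks and increasing relabelling\<close>

lemma blocks_partition: "\<exists>n\<ge>1. partition_on {1..n} (blocks \<pi>)"
  using blocks[of \<pi>] by blast

lemma blocks_noncrossing: "noncrossing (blocks \<pi>)"
  using blocks[of \<pi>] by blast

lemma finite_blocks [simp]: "finite (blocks \<pi>)"
  using blocks_partition[of \<pi>] finite_elements by (metis finite_atLeastAtMost)

lemma blocks_nonempty [simp]: "blocks \<pi> \<noteq> {}"
proof
  obtain n where n: "n \<ge> 1" "partition_on {1..n} (blocks \<pi>)" using blocks_partition by blast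
  assume "blocks \<pi> = {}"
  then have "{1..n} = {}" using partition_onD1[OF n(2)] by simp
  then show False using n(1) by simp
qed

lemma card_blocks_pos: "card (blocks \<pi>) > 0"
  by (simp add: card_gt_0_iff)

lemma block_finite: "b \<in> blocks \<pi> \<Longrightarrow> finite b"
  using blocks_partition[of \<pi>] partition_onD1 by (metis Union_upper finite_atLeastAtMost finite_subset)

lemma block_nonempty: "b \<in> blocks \<pi> \<Longrightarrow> b \<noteq> {}"
  using blocks_partition[of \<pi>] partition_onD3 by metis

lemma blocks_disjoint: "disjoint (blocks \<pi>)"
  using blocks_partition[of \<pi>] partition_onD2 by metis

text \<open>Restrictions of \<open>\<pi>\<close> are standardized, but it is convenient to compute with the original blocks. The
following lemmas show that \<^const>\<open>hat\<close> and, later, the product dual to \<^const>\<open>delta\<close> only depend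
on blocks up to increasing relabelling; standardization is the relabelling by rank.\<close>

definition relabel :: "(nat \<Rightarrow> nat) \<Rightarrow> nat set set \<Rightarrow> nat set set" where
  "relabel \<rho> Z = (\<lambda>b. \<rho> ` b) ` Z"

lemma Union_relabel: "\<Union>(relabel \<rho> Z) = \<rho> ` \<Union>Z"
  by (auto simp: relabel_def)

lemma relabel_empty_iff [simp]: "relabel \<rho> Z = {} \<longleftrightarrow> Z = {}"
  by (simp add: relabel_def)

lemma standardize_relabel:
  assumes "strict_mono_on (\<Union>Z) \<rho>"
  shows "standardize (relabel \<rho> Z) = standardize Z"
proof -
  have "card {y \<in> \<rho> ` \<Union>Z. y \<le> \<rho> x} = card {y \<in> \<Union>Z. y \<le> x}" if "x \<in> \<Union>Z" for x
  proof -
    have "{y \<in> \<rho> ` \<Union>Z. y \<le> \<rho> x} = \<rho> ` {y \<in> \<Union>Z. y \<le> x}"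
      using strict_mono_on_less_eq[OF assms] that by auto
    moreover have "inj_on \<rho> {y \<in> \<Union>Z. y \<le> x}"
      by (rule inj_on_subset[OF strict_mono_on_imp_inj_on[OF assms]]) auto
    ultimately show ?thesis by (simp add: card_image)
  qed
  then have "(\<lambda>x. card {y \<in> \<rho> ` \<Union>Z. y \<le> x}) ` \<rho> ` b = (\<lambda>x. card {y \<in> \<Union>Z. y \<le> x}) ` b"
    if "b \<in> Z" for b
    unfolding image_image using that by (intro image_cong) auto
  then show ?thesis
    unfolding standardize_def Union_relabel by (simp add: relabel_def image_image)
qed

lemma hat_relabel: "strict_mono_on (\<Union>Z) \<rho> \<Longrightarrow> hat f (relabel \<rho> Z) = hat f Z"
  by (simp add: hat_def standard_def standardize_relabel)

lemma noncrossing_relabel: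
  assumes "strict_mono_on (\<Union>Z) \<rho>" "noncrossing Z"
  shows "noncrossing (relabel \<rho> Z)"
proof (rule ccontr)
  assume "\<not> noncrossing (relabel \<rho> Z)"
  then obtain b' c' x' y' z' t' where h': "b' \<in> relabel \<rho> Z" "c' \<in> relabel \<rho> Z" "b' \<noteq> c'"
    "x' \<in> b'" "y' \<in> c'" "z' \<in> b'" "t' \<in> c'" "x' < y'" "y' < z'" "z' < t'"
    unfolding noncrossing_def not_not by (elim bexE conjE)
  obtain b c where bc: "b \<in> Z" "c \<in> Z" "b' = \<rho> ` b" "c' = \<rho> ` c"
    using h'(1,2) unfolding relabel_def by blast
  obtain x y z t where h: "b \<in> Z" "c \<in> Z" "\<rho> ` b \<noteq> \<rho> ` c"
    "x \<in> b" "y \<in> c" "z \<in> b" "t \<in> c" "\<rho> x < \<rho> y" "\<rho> y < \<rho> z" "\<rho> z < \<rho> t"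
    using bc(1,2) h'(3-10) unfolding bc(3,4) by (elim imageE) simp
  have less: "u < v" if "\<rho> u < \<rho> v" "u \<in> \<Union>Z" "v \<in> \<Union>Z" for u v
    using iffD1[OF strict_mono_on_less[OF assms(1) that(2,3)] that(1)] .
  have "x \<in> \<Union>Z" "y \<in> \<Union>Z" "z \<in> \<Union>Z" "t \<in> \<Union>Z" using h(1,2,4-7) by blast+
  then have lt: "x < y" "y < z" "z < t" using less[OF h(8)] less[OF h(9)] less[OF h(10)] by blast+
  have "\<exists>x\<in>b. \<exists>y\<in>c. \<exists>z\<in>b. \<exists>t\<in>c. x < y \<and> y < z \<and> z < t"
    by (intro bexI conjI) (fact lt h)+
  then have "\<not> noncrossing Z"
    unfolding noncrossing_def not_not
    by (intro bexI[of _ b] bexI[of _ c] conjI) (use h(1-3) in \<open>blast | fact\<close>)+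
  then show False using assms(2) by contradiction
qed

lemma standardize_eq_relabel: "standardize Z = relabel (\<lambda>x. card {y \<in> \<Union>Z. y \<le> x}) Z"
  by (simp add: standardize_def relabel_def)

lemma strict_mono_on_rank: "strict_mono_on A (\<lambda>x::nat. card {y \<in> A. y \<le> x})"
proof (rule strict_mono_onI)
  fix r s assume "r \<in> A" "s \<in> A" "r < s"
  then have "s \<in> {y \<in> A. y \<le> s}" "s \<notin> {y \<in> A. y \<le> r}" "{y \<in> A. y \<le> r} \<subseteq> {y \<in> A. y \<le> s}"
    by auto
  then show "card {y \<in> A. y \<le> r} < card {y \<in> A. y \<le> s}"
    by (intro psubset_card_mono) (simp, blast)
qed

lemma standard_blocks: "standard (blocks \<pi>) = \<pi>"
proof -
  obtain n where n: "partition_on {1..n} (blocks \<pi>)" using blocks_partition by blast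
  have "\<Union>(blocks \<pi>) = {1..n}" using n by (simp add: partition_on_def)
  moreover have "{y \<in> {1..n}. y \<le> x} = {1..x}" if "x \<in> {1..n}" for x
    using that by auto
  ultimately have "card {y \<in> \<Union>(blocks \<pi>). y \<le> x} = x" if "x \<in> \<Union>(blocks \<pi>)" for x
    using that by simp
  then have "(\<lambda>x. card {y \<in> \<Union>(blocks \<pi>). y \<le> x}) ` b = (\<lambda>x. x) ` b" if "b \<in> blocks \<pi>" for b
    using that by (intro image_cong) blast+
  then have "standardize (blocks \<pi>) = blocks \<pi>" by (simp add: standardize_def)
  then show ?thesis by (simp add: standard_def blocks_inverse)
qed

lemma hat_blocks: "hat f (blocks \<pi>) = f \<pi>"
  by (simp add: hat_def standard_blocks)

lemma hat_eq: "blocks \<pi> = Z \<Longrightarrow> hat f Z = f \<pi>"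
  using hat_blocks[of f \<pi>] by simp

section \<open>Contractions\<close>

text \<open>The equivalences in \<^const>\<open>Ec\<close>, encoded as partitions of the set of blocks. Partitions can be cut and
glued by set difference and union, and they make sense for a set \<open>Y\<close> of blocks that need not be all the
blocks of a noncrossing partition.\<close>

definition contractions :: "nat set set \<Rightarrow> nat set set set set" where
  "contractions Y = {P. partition_on Y P \<and> noncrossing (Union ` P)}"

lemma finite_contractions [simp]: "finite Y \<Longrightarrow> finite (contractions Y)"
  by (rule finite_subset[OF _ finitely_many_partition_on]) (auto simp: contractions_def)

lemma contraction_finite: "finite Y \<Longrightarrow> P \<in> contractions Y \<Longrightarrow> finite P"
  by (auto simp: contractions_def intro: finite_elements)

lemma contraction_empty: "contractions {} = {{}}"
  by (auto simp: contractions_def partition_on_empty noncrossing_def)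

lemma contraction_relabel:
  assumes \<rho>: "strict_mono_on (\<Union>Y) \<rho>" and P: "P \<in> contractions Y"
  shows "relabel \<rho> ` P \<in> contractions (relabel \<rho> Y)" "Union ` relabel \<rho> ` P = relabel \<rho> (Union ` P)"
proof -
  have part: "partition_on Y P" and nc: "noncrossing (Union ` P)" using P by (auto simp: contractions_def)
  have UP: "\<Union>(Union ` P) = \<Union>Y" using part by (auto simp: partition_on_def)
  show U: "Union ` relabel \<rho> ` P = relabel \<rho> (Union ` P)"
    unfolding image_image Union_relabel by (simp add: relabel_def image_image)
  have inj: "inj_on (\<lambda>b. \<rho> ` b) Y"
    by (rule inj_on_subset[OF inj_on_image_Pow[OF strict_mono_on_imp_inj_on[OF \<rho>]]]) auto
  have "partition_on (relabel \<rho> Y) (relabel \<rho> ` P - {{}})"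
    using partition_on_inj_image[OF part inj] by (simp add: relabel_def[abs_def])
  moreover have "{} \<notin> relabel \<rho> ` P"
    using partition_onD3[OF part] by (metis imageE relabel_empty_iff)
  ultimately show "relabel \<rho> ` P \<in> contractions (relabel \<rho> Y)"
    using noncrossing_relabel[OF \<rho>[folded UP] nc] U by (simp add: contractions_def)
qed

text \<open>The product dual to \<^const>\<open>delta\<close>, evaluated on a set of blocks without standardizing it.\<close>

definition star_on :: "(ncp \<Rightarrow> 'k::field_char_0) \<Rightarrow> (ncp \<Rightarrow> 'k) \<Rightarrow> nat set set \<Rightarrow> 'k" where
  "star_on f g Y = (\<Sum>P\<in>contractions Y. hat f (Union ` P) * (\<Prod>C\<in>P. hat g C))"

lemma relabel_inverse:
  assumes "strict_mono_on A \<rho>" "\<Union>Z \<subseteq> A"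
  shows "relabel (inv_into A \<rho>) (relabel \<rho> Z) = Z"
proof -
  have "inv_into A \<rho> ` \<rho> ` b = b" if "b \<in> Z" for b
    using that assms strict_mono_on_imp_inj_on[OF assms(1)] by (intro inv_into_image_cancel) auto
  then show ?thesis by (simp add: relabel_def image_image)
qed

lemma strict_mono_on_inv_into:
  fixes \<rho> :: "nat \<Rightarrow> nat"
  assumes "strict_mono_on A \<rho>"
  shows "strict_mono_on (\<rho> ` A) (inv_into A \<rho>)"
proof (rule strict_mono_onI)
  fix r s assume "r \<in> \<rho> ` A" "s \<in> \<rho> ` A" "r < s"
  then show "inv_into A \<rho> r < inv_into A \<rho> s"
    using strict_mono_on_less[OF assms, of "inv_into A \<rho> r" "inv_into A \<rho> s"]
    by (simp add: inv_into_into f_inv_into_f)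
qed

text \<open>An increasing relabelling maps contractions to contractions, and its inverse maps them back.\<close>

lemma star_on_relabel:
  assumes \<rho>: "strict_mono_on (\<Union>Y) \<rho>"
  shows "star_on f g (relabel \<rho> Y) = star_on f g Y"
proof -
  let ?\<sigma> = "inv_into (\<Union>Y) \<rho>"
  have \<sigma>: "strict_mono_on (\<Union>(relabel \<rho> Y)) ?\<sigma>"
    unfolding Union_relabel by (rule strict_mono_on_inv_into[OF \<rho>])
  have left_inv: "relabel ?\<sigma> (relabel \<rho> Z) = Z" if "Z \<subseteq> Y" for Z
    by (rule relabel_inverse[OF \<rho>]) (use that in auto)
  have right_inv: "relabel \<rho> (relabel ?\<sigma> Z) = Z" if Z: "Z \<subseteq> relabel \<rho> Y" for Z
  proof -
    have "\<rho> ` ?\<sigma> ` b = b" if "b \<in> Z" for b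
    proof (rule image_inv_into_cancel[OF refl])
      have "\<Union>Z \<subseteq> \<rho> ` \<Union>Y" using Union_mono[OF Z] by (simp add: Union_relabel)
      then show "b \<subseteq> \<rho> ` \<Union>Y" using that by blast
    qed
    then show ?thesis by (simp add: relabel_def image_image)
  qed
  have sub: "C \<subseteq> Z" if "P \<in> contractions Z" "C \<in> P" for P C Z
    using that by (auto simp: contractions_def partition_on_def)
  have "star_on f g Y = star_on f g (relabel \<rho> Y)"
    unfolding star_on_def
  proof (rule sum.reindex_bij_witness[where j = "\<lambda>P. relabel \<rho> ` P" and i = "\<lambda>P. relabel ?\<sigma> ` P"])
    fix P assume P: "P \<in> contractions Y"
    have Psub: "\<And>C. C \<in> P \<Longrightarrow> C \<subseteq> Y" using sub[OF P] .
    show "relabel \<rho> ` P \<in> contractions (relabel \<rho> Y)" by (rule contraction_relabel[OF \<rho> P])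
    have "(\<lambda>C. relabel ?\<sigma> (relabel \<rho> C)) ` P = (\<lambda>C. C) ` P"
      by (rule image_cong) (auto intro!: left_inv Psub)
    then show "relabel ?\<sigma> ` relabel \<rho> ` P = P" by (simp add: image_image)
    have UP: "\<Union>(Union ` P) = \<Union>Y" using P by (auto simp: contractions_def partition_on_def)
    have inj: "inj_on (relabel \<rho>) P"
      by (rule inj_on_inverseI[where g = "relabel ?\<sigma>"]) (auto intro!: left_inv Psub)
    have "hat g (relabel \<rho> C) = hat g C" if "C \<in> P" for C
      by (rule hat_relabel, rule monotone_on_subset[OF \<rho>]) (use Psub[OF that] in blast)
    then show "hat f (Union ` relabel \<rho> ` P) * (\<Prod>C\<in>relabel \<rho> ` P. hat g C) =
        hat f (Union ` P) * (\<Prod>C\<in>P. hat g C)"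
      unfolding contraction_relabel(2)[OF \<rho> P] prod.reindex[OF inj] hat_relabel[OF \<rho>[folded UP]] by simp
  next
    fix P assume P: "P \<in> contractions (relabel \<rho> Y)"
    show "relabel ?\<sigma> ` P \<in> contractions Y"
      using contraction_relabel(1)[OF \<sigma> P] left_inv[of Y] by simp
    have "(\<lambda>C. relabel \<rho> (relabel ?\<sigma> C)) ` P = (\<lambda>C. C) ` P"
      by (rule image_cong) (auto intro!: right_inv sub[OF P])
    then show "relabel \<rho> ` relabel ?\<sigma> ` P = P" by (simp add: image_image)
  qed
  then show ?thesis ..
qed

definition star_fn :: "(ncp \<Rightarrow> 'k::field_char_0) \<Rightarrow> (ncp \<Rightarrow> 'k) \<Rightarrow> ncp \<Rightarrow> 'k" where
  "star_fn f g \<pi> = star_on f g (blocks \<pi>)"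

lemma hat_star_fn:
  assumes "Y \<subseteq> blocks \<pi>"
  shows "hat (star_fn f g) Y = star_on f g Y"
proof (cases "Y = {}")
  case True
  then show ?thesis by (simp add: hat_def star_on_def contraction_empty)
next
  case False
  then have "blocks (standard Y) = standardize Y"
    unfolding standard_def by (rule standardize_ncp[OF assms])
  then show ?thesis
    using False star_on_relabel[OF strict_mono_on_rank[of "\<Union>Y"]]
    by (simp add: hat_def star_fn_def standardize_eq_relabel)
qed

text \<open>Equivalence relations correspond to partitions by passing to the quotient.\<close>

lemma sum_Ec_eq_sum_contractions: "(\<Sum>r\<in>Ec \<pi>. F (blocks \<pi> // r)) = (\<Sum>P\<in>contractions (blocks \<pi>). F P)"
proof (rule sum.reindex_bij_witness[where j = "\<lambda>r. blocks \<pi> // r"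
      and i = "\<lambda>P. {(x, y). \<exists>p\<in>P. x \<in> p \<and> y \<in> p}"])
  fix r assume "r \<in> Ec \<pi>"
  then have r: "equiv (blocks \<pi>) r" "noncrossing (Union ` (blocks \<pi> // r))"
    by (auto simp: Ec_def merge_def)
  show "blocks \<pi> // r \<in> contractions (blocks \<pi>)"
    using r partition_on_quotient[OF r(1)] by (simp add: contractions_def)
  show "{(x, y). \<exists>p\<in>blocks \<pi> // r. x \<in> p \<and> y \<in> p} = r"
  proof (intro set_eqI iffI; clarify)
    fix x y p assume "p \<in> blocks \<pi> // r" "x \<in> p" "y \<in> p"
    then show "(x, y) \<in> r" using quotient_eq_iff[OF r(1), of p p x y] by simp
  next
    fix x y assume xy: "(x, y) \<in> r"
    then have "x \<in> blocks \<pi>" using r(1) by (auto elim!: equivE)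
    then show "\<exists>p\<in>blocks \<pi> // r. x \<in> p \<and> y \<in> p"
      using xy equiv_class_self[OF r(1)] by (intro bexI[of _ "r `` {x}"]) (auto intro: quotientI)
  qed
next
  fix P assume "P \<in> contractions (blocks \<pi>)"
  then have P: "partition_on (blocks \<pi>) P" "noncrossing (Union ` P)" by (auto simp: contractions_def)
  show q: "blocks \<pi> // {(x, y). \<exists>p\<in>P. x \<in> p \<and> y \<in> p} = P"
    by (rule partition_on_eq_quotient[OF P(1)])
  show "{(x, y). \<exists>p\<in>P. x \<in> p \<and> y \<in> p} \<in> Ec \<pi>"
    using P(2) equiv_partition_on[OF P(1)] by (simp add: Ec_def merge_def q)
qed simp

lemma hat_quotient:
  assumes "r \<in> Ec \<pi>"
  shows "hat f (Union ` (blocks \<pi> // r)) = f (quotient_ncp \<pi> r)"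
  using merge_ncp[OF assms] by (simp add: merge_def flip: hat_blocks)

text \<open>This transfers what is known about the blocks of a noncrossing partition to the merged blocks of a
contraction.\<close>

lemma contraction_quotient:
  assumes "P \<in> contractions (blocks \<pi>)"
  shows "\<exists>q. blocks q = Union ` P"
proof -
  let ?r = "{(x, y). \<exists>p\<in>P. x \<in> p \<and> y \<in> p}"
  have P: "partition_on (blocks \<pi>) P" "noncrossing (Union ` P)" using assms by (auto simp: contractions_def)
  have q: "blocks \<pi> // ?r = P" by (rule partition_on_eq_quotient[OF P(1)])
  have r: "?r \<in> Ec \<pi>" using P(2) equiv_partition_on[OF P(1)] by (simp add: Ec_def merge_def q)
  show ?thesis using merge_ncp[OF r] unfolding merge_def q by blast
qed

lemma star_char_ext: "star (char_ext f) (char_ext g) = char_ext (star_fn f g)"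
proof -
  have "(\<Sum>r\<in>Ec \<pi>. f (quotient_ncp \<pi> r) * (\<Prod>C\<in>blocks \<pi> // r. hat g C)) = star_fn f g \<pi>" for \<pi>
    unfolding star_fn_def star_on_def
    by (subst sum_Ec_eq_sum_contractions[symmetric]) (simp add: hat_quotient)
  then show ?thesis by (simp add: star_char_ext_Ec)
qed

lemma contraction_one_class:
  assumes "P \<in> contractions Y" "card P = 1"
  shows "P = {Y}"
  using assms by (auto simp: contractions_def partition_on_def card_1_singleton_iff)

lemma contraction_indiscrete: "Y \<noteq> {} \<Longrightarrow> {Y} \<in> contractions Y"
  by (auto simp: contractions_def partition_on_space noncrossing_def)

lemma contraction_discrete: "{{b} | b. b \<in> blocks \<pi>} \<in> contractions (blocks \<pi>)"
proof -
  have "{{b} | b. b \<in> blocks \<pi>} = (\<lambda>b. {b}) ` blocks \<pi>" by auto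
  then show ?thesis
    using partition_on_singletons[of "blocks \<pi>"] blocks_noncrossing[of \<pi>]
    by (simp add: contractions_def image_image)
qed

lemma contraction_sum_card:
  assumes "finite Y" "P \<in> contractions Y"
  shows "(\<Sum>C\<in>P. card C) = card Y"
proof -
  have "partition_on Y P" using assms(2) by (simp add: contractions_def)
  moreover have "finite p" if "p \<in> P" for p
    using that assms by (auto simp: contractions_def partition_on_def intro: finite_subset)
  ultimately show ?thesis by (simp add: product_partition)
qed

lemma contraction_class:
  assumes "finite Y" "P \<in> contractions Y" "C \<in> P"
  shows "C \<noteq> {}" "C \<subseteq> Y" "finite C" "card C > 0"
proof -
  show *: "C \<noteq> {}" "C \<subseteq> Y" using assms by (auto simp: contractions_def partition_on_def)
  show "finite C" using *(2) assms(1) by (rule finite_subset)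
  then show "card C > 0" using * by (simp add: card_gt_0_iff)
qed

lemma contraction_card_le:
  assumes "finite Y" "P \<in> contractions Y"
  shows "card P \<le> card Y"
proof -
  have "(\<Sum>C\<in>P. 1) \<le> (\<Sum>C\<in>P. card C)"
    using contraction_class(4)[OF assms] by (intro sum_mono) (simp add: Suc_le_eq)
  then show ?thesis using contraction_sum_card[OF assms] by simp
qed

lemma contraction_card_eq:
  assumes "finite Y" "P \<in> contractions Y" "card P = card Y"
  shows "P = {{b} | b. b \<in> Y}"
proof -
  have one: "card C = 1" if "C \<in> P" for C
  proof (rule ccontr)
    assume "card C \<noteq> 1"
    then have "1 < card C" using contraction_class(4)[OF assms(1,2) that] by simp
    then have "(\<Sum>C\<in>P. 1) < (\<Sum>C\<in>P. card C)"
      using contraction_class(4)[OF assms(1,2)] contraction_finite[OF assms(1,2)] that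
      by (intro sum_strict_mono_ex1) (auto simp: Suc_le_eq)
    then show False using contraction_sum_card[OF assms(1,2)] assms(3) by simp
  qed
  have "\<Union>P = Y" using assms(2) by (simp add: contractions_def partition_on_def)
  show ?thesis
  proof (intro set_eqI iffI)
    fix C assume C: "C \<in> P"
    then obtain b where "C = {b}" using one card_1_singletonE by blast
    then show "C \<in> {{b} | b. b \<in> Y}" using C \<open>\<Union>P = Y\<close> by auto
  next
    fix C assume "C \<in> {{b} | b. b \<in> Y}"
    then obtain b where b: "C = {b}" "b \<in> \<Union>P" using \<open>\<Union>P = Y\<close> by auto
    then obtain D where D: "D \<in> P" "b \<in> D" by auto
    then obtain b' where "D = {b'}" using one card_1_singletonE by blast
    then show "C \<in> P" using b D by simp
  qed
qed

text \<open>The classes of a nontotal contraction are smaller than the whole. All recursions and inductions on the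
number of blocks rest on this.\<close>

lemma contraction_card_less:
  assumes "finite Y" "P \<in> contractions Y" "P \<noteq> {Y}" "C \<in> P"
  shows "card C < card Y"
proof (rule ccontr)
  assume "\<not> card C < card Y"
  then have CY: "C = Y"
    using contraction_class[OF assms(1,2,4)] assms(1) by (meson card_seteq not_less)
  have "D = Y" if "D \<in> P" for D
  proof (rule ccontr)
    assume "D \<noteq> Y"
    moreover have "disjoint P" using assms(2) by (simp add: contractions_def partition_on_def)
    ultimately have "D \<inter> Y = {}" using that assms(4) CY disjointD by metis
    then show False using contraction_class(1,2)[OF assms(1,2) that] by auto
  qed
  then show False using assms(3,4) CY by blast
qed

lemma card_Union_image_contractions:
  assumes "P \<in> contractions (blocks \<pi>)"
  shows "inj_on Union P" "card (Union ` P) = card P"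
proof -
  have P: "partition_on (blocks \<pi>) P" using assms by (simp add: contractions_def)
  show "inj_on Union P"
  proof (rule inj_onI)
    fix C D assume h: "C \<in> P" "D \<in> P" "\<Union>C = \<Union>D"
    obtain b where b: "b \<in> C" "b \<in> blocks \<pi>"
      using contraction_class(1,2)[OF finite_blocks assms h(1)] by blast
    obtain x where x: "x \<in> b" using block_nonempty[OF b(2)] by auto
    then obtain c where c: "c \<in> D" "x \<in> c" using b h(3) by blast
    then have "c \<in> blocks \<pi>" using contraction_class(2)[OF finite_blocks assms h(2)] by blast
    then have "b = c" using disjointD[OF blocks_disjoint b(2)] x c(2) by blast
    then show "C = D" using disjointD[OF partition_onD2[OF P] h(1,2)] b(1) c(1) by blast
  qed
  then show "card (Union ` P) = card P" by (rule card_image)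
qed

section \<open>Compatibility of the two coproducts\<close>

lemma segmentsD:
  assumes "I \<in> segments A"
  shows "I \<noteq> {}" "I \<subseteq> A" "\<exists>i j. I = {i..j}" "\<And>i j. {i..j} \<subseteq> A \<Longrightarrow> I \<subseteq> {i..j} \<Longrightarrow> {i..j} = I"
  using assms unfolding segments_def by blast+

lemma finite_segments: "finite A \<Longrightarrow> finite (segments A)"
  by (rule finite_subset[of _ "Pow A"]) (auto simp: segments_def)

lemma segment_convex:
  assumes "I \<in> segments A" "x \<in> I" "z \<in> I" "x \<le> y" "y \<le> z"
  shows "y \<in> I"
proof -
  obtain i j where "I = {i..j}" using segmentsD(3)[OF assms(1)] by blast
  then show ?thesis using assms(2-5) by simp
qed

text \<open>Take an interval that is maximal among those between \<open>{i..j}\<close> and \<open>A\<close>.\<close>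

lemma interval_subset_segment:
  fixes i j :: nat
  assumes "finite A" "{i..j} \<subseteq> A" "i \<le> j"
  shows "\<exists>I\<in>segments A. {i..j} \<subseteq> I"
proof -
  let ?S = "{K. K \<subseteq> A \<and> (\<exists>i j. K = {i..j})}"
  have fin: "finite ?S" by (rule finite_subset[of _ "Pow A"]) (use assms(1) in auto)
  have "{i..j} \<in> ?S" using assms(2) by blast
  from finite_has_maximal2[OF fin this] obtain I
    where I: "I \<in> ?S" "{i..j} \<subseteq> I" and max: "\<forall>K\<in>?S. I \<subseteq> K \<longrightarrow> I = K" by (elim bexE conjE)
  have "I \<noteq> {}" using I(2) assms(3) by auto
  moreover have "{i'..j'} = I" if "{i'..j'} \<subseteq> A" "I \<subseteq> {i'..j'}" for i' j'
    using bspec[OF max, of "{i'..j'}"] that by (metis (mono_tags, lifting) mem_Collect_eq)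
  moreover have "I \<subseteq> A" "\<exists>i j. I = {i..j}" using I(1) by simp_all
  ultimately have "I \<in> segments A" unfolding segments_def by blast
  then show ?thesis using I(2) by blast
qed

text \<open>The union of two intervals that meet is an interval, so maximality makes both equal to it.\<close>

lemma segments_disjoint:
  assumes "I \<in> segments A" "I' \<in> segments A" "x \<in> I" "x \<in> I'"
  shows "I = I'"
proof -
  obtain i j i' j' where ij: "I = {i..j}" "I' = {i'..j'}"
    using segmentsD(3)[OF assms(1)] segmentsD(3)[OF assms(2)] by blast
  have U: "{min i i'..max j j'} = I \<union> I'"
    using assms(3,4) unfolding ij by (auto simp: min_def max_def)
  have sub: "{min i i'..max j j'} \<subseteq> A"
    unfolding U using segmentsD(2)[OF assms(1)] segmentsD(2)[OF assms(2)] by blast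
  have "{min i i'..max j j'} = I" by (rule segmentsD(4)[OF assms(1) sub]) (simp add: U)
  moreover have "{min i i'..max j j'} = I'" by (rule segmentsD(4)[OF assms(2) sub]) (simp add: U)
  ultimately show ?thesis by simp
qed

lemma noncrossing_subset: "noncrossing Z \<Longrightarrow> Z' \<subseteq> Z \<Longrightarrow> noncrossing Z'"
  unfolding noncrossing_def by (meson subsetD)

lemma noncrossingD:
  assumes "noncrossing Z" "c \<in> Z" "d \<in> Z" "x \<in> c" "y \<in> d" "z \<in> c" "t \<in> d" "x < y" "y < z" "z < t"
  shows "c = d"
  using assms unfolding noncrossing_def by meson

lemma noncrossingI:
  assumes "\<And>c d x y z t. c \<in> Z \<Longrightarrow> d \<in> Z \<Longrightarrow> x \<in> c \<Longrightarrow> y \<in> d \<Longrightarrow> z \<in> c \<Longrightarrow> t \<in> d \<Longrightarrow>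
    x < y \<Longrightarrow> y < z \<Longrightarrow> z < t \<Longrightarrow> c = d"
  shows "noncrossing Z"
  unfolding noncrossing_def
proof (rule notI, elim bexE conjE)
  fix c d x y z t
  assume "c \<in> Z" "d \<in> Z" "c \<noteq> d" "x \<in> c" "y \<in> d" "z \<in> c" "t \<in> d" "x < y" "y < z" "z < t"
  then show False using assms[of c d x y z t] by simp
qed

text \<open>A point of \<open>d\<close> strictly between the end points of \<open>c\<close>, together with a point of \<open>d\<close> outside their range,
would be a crossing.\<close>

lemma nested_if_meets:
  assumes nc: "noncrossing Z" and cd: "c \<in> Z" "d \<in> Z" and c: "finite c" "c \<noteq> {}"
    and dj: "c \<noteq> d \<Longrightarrow> c \<inter> d = {}" and x: "x \<in> d" "x \<in> {Min c..Max c}"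
  shows "nest_le c d"
proof (cases "c = d")
  case True
  then show ?thesis using c by (auto simp: nest_le_def)
next
  case False
  have mm: "Min c \<in> c" "Max c \<in> c" using c by simp_all
  have "Min c \<noteq> x" "Max c \<noteq> x" using mm x(1) dj[OF False] by blast+
  then have x': "Min c < x" "x < Max c" using x(2) by simp_all
  have "y \<in> {Min c..Max c}" if y: "y \<in> d" for y
  proof (rule ccontr)
    assume "y \<notin> {Min c..Max c}"
    then consider "y < Min c" | "Max c < y" by fastforce
    then have "c = d"
    proof cases
      case 1
      then show ?thesis using noncrossingD[OF nc cd(2,1) y mm(1) x(1) mm(2)] x' by simp
    next
      case 2
      then show ?thesis using noncrossingD[OF nc cd mm(1) x(1) mm(2) y] x' by simp
    qed
    then show False using False by contradiction
  qed
  then show ?thesis unfolding nest_le_def by blast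
qed

lemma block_eq: "b \<in> blocks \<pi> \<Longrightarrow> b' \<in> blocks \<pi> \<Longrightarrow> x \<in> b \<Longrightarrow> x \<in> b' \<Longrightarrow> b = b'"
  using disjointD[OF blocks_disjoint, of b \<pi> b'] by blast

lemma ideal_subset: "J \<in> ideals \<pi> \<Longrightarrow> J \<subseteq> blocks \<pi>"
  by (simp add: ideals_def)

lemma idealD: "J \<in> ideals \<pi> \<Longrightarrow> b \<in> J \<Longrightarrow> b' \<in> blocks \<pi> \<Longrightarrow> nest_le b b' \<Longrightarrow> b' \<in> J"
  by (simp add: ideals_def)

lemma finite_ideals [simp]: "finite (ideals \<pi>)"
  by (rule finite_subset[of _ "Pow (blocks \<pi>)"]) (auto simp: ideals_def)

lemma finite_Union_blocks: "J \<subseteq> blocks \<pi> \<Longrightarrow> finite (\<Union>J)"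
  using finite_subset[OF _ finite_blocks] block_finite by (intro finite_Union) blast+

text \<open>A block that meets the range of \<open>b\<close> is nested in \<open>b\<close>, hence belongs to the ideal. So each block of an
ideal lies in a single segment, also when the blocks are the merged blocks of a contraction.\<close>

lemma ideal_hull:
  assumes J: "J \<in> ideals \<pi>" "b \<in> J"
  shows "{Min b..Max b} \<subseteq> \<Union>J"
proof
  fix x assume x: "x \<in> {Min b..Max b}"
  have b: "b \<in> blocks \<pi>" using ideal_subset[OF J(1)] J(2) by blast
  note fin = block_finite[OF b] block_nonempty[OF b]
  obtain n where n: "\<Union>(blocks \<pi>) = {1..n}"
    using blocks_partition[of \<pi>] partition_onD1 by metis
  have "Min b \<in> {1..n}" "Max b \<in> {1..n}" 
    unfolding n[symmetric] using Min_in[OF fin] Max_in[OF fin] b by blast+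
  then have "x \<in> {1..n}" using x by simp
  then obtain d where d: "d \<in> blocks \<pi>" "x \<in> d" unfolding n[symmetric] by blast
  have "nest_le b d"
    by (rule nested_if_meets[OF blocks_noncrossing b d(1) fin _ d(2) x])
      (use block_eq[OF b d(1)] in blast)
  then have "d \<in> J" by (rule idealD[OF J d(1)])
  then show "x \<in> \<Union>J" using d(2) by blast
qed

lemma ideal_block_in_segment:
  assumes J: "J \<in> ideals \<pi>" "b \<in> J"
  shows "\<exists>I\<in>segments (\<Union>J). b \<subseteq> I"
proof -
  have b: "b \<in> blocks \<pi>" using ideal_subset[OF J(1)] J(2) by blast
  note fin = block_finite[OF b] block_nonempty[OF b]
  obtain I where I: "I \<in> segments (\<Union>J)" "{Min b..Max b} \<subseteq> I"
    using interval_subset_segment[OF finite_Union_blocks[OF ideal_subset[OF J(1)]] ideal_hull[OF J]] fin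
    by (meson Max_ge Min_in)
  moreover have "b \<subseteq> {Min b..Max b}" using fin by auto
  ultimately show ?thesis by blast
qed

text \<open>The contractions of an ideal that merge only blocks of the same segment. They encode the families
consisting of one contraction for each segment.\<close>

definition seg_contractions :: "nat set set \<Rightarrow> nat set set set set" where
  "seg_contractions J = {Q \<in> contractions J. \<forall>C\<in>Q. \<exists>I\<in>segments (\<Union>J). \<Union>C \<subseteq> I}"

lemma contractionD:
  assumes "P \<in> contractions Y"
  shows "\<Union>P = Y" "{} \<notin> P" "noncrossing (Union ` P)" "C \<in> P \<Longrightarrow> D \<in> P \<Longrightarrow> b \<in> C \<Longrightarrow> b \<in> D \<Longrightarrow> C = D"
proof -
  show "\<Union>P = Y" "{} \<notin> P" "noncrossing (Union ` P)" and
    "C \<in> P \<Longrightarrow> D \<in> P \<Longrightarrow> b \<in> C \<Longrightarrow> b \<in> D \<Longrightarrow> C = D"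
    using assms disjointD[of P C D] by (auto simp: contractions_def partition_on_def)
qed

lemma contractionI:
  assumes "\<Union>P = Y" "{} \<notin> P" "noncrossing (Union ` P)"
    "\<And>C D b. C \<in> P \<Longrightarrow> D \<in> P \<Longrightarrow> b \<in> C \<Longrightarrow> b \<in> D \<Longrightarrow> C = D"
  shows "P \<in> contractions Y"
  unfolding contractions_def partition_on_def using assms(1-3) assms(4) by (auto intro!: disjointI)

lemma class_element:
  assumes Y: "Y \<subseteq> blocks \<pi>" and P: "P \<in> contractions Y" and C: "C \<in> P"
  obtains b x where "b \<in> C" "x \<in> b" "b \<in> Y"
proof -
  obtain b where b: "b \<in> C" using C contractionD(2)[OF P] by (metis ex_in_conv)
  then have bY: "b \<in> Y" using contractionD(1)[OF P] C by blast
  then obtain x where "x \<in> b" using block_nonempty Y by (metis ex_in_conv subsetD)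
  then show ?thesis using that b bY by blast
qed

text \<open>One half of the bijection behind the distributivity law: a contraction \<open>P\<close> of \<open>\<pi>\<close> with an ideal \<open>K\<close> of
the quotient restricts to the blocks inside \<open>K\<close> and to the remaining ones. If \<open>b'\<close> is nested in a block
\<open>b\<close> of the class \<open>C\<close>, the merged block of \<open>b'\<close> meets the range of \<open>\<Union>C\<close> and hence is nested in it; so
the blocks inside \<open>K\<close> form an ideal of \<open>\<pi>\<close>.\<close>

lemma split_contraction:
  assumes P: "P \<in> contractions (blocks \<pi>)" and q: "blocks q = Union ` P" and K: "K \<in> ideals q"
  defines "Q \<equiv> {C \<in> P. \<Union>C \<in> K}"
  shows "\<Union>Q \<in> ideals \<pi>" "P - Q \<in> contractions (blocks \<pi> - \<Union>Q)" "Q \<in> seg_contractions (\<Union>Q)" "Union ` Q = K"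
proof -
  have QP: "Q \<subseteq> P" by (auto simp: Q_def)
  show UQ: "Union ` Q = K" using ideal_subset[OF K] unfolding q Q_def by blast
  have UUQ: "\<Union>(\<Union>Q) = \<Union>K" unfolding UQ[symmetric] by blast
  have QY: "\<Union>Q \<subseteq> blocks \<pi>" using QP contractionD(1)[OF P] by blast
  show "\<Union>Q \<in> ideals \<pi>"
    unfolding ideals_def mem_Collect_eq
  proof (intro conjI QY ballI impI)
    fix b b' assume h: "b \<in> \<Union>Q" "b' \<in> blocks \<pi>" "nest_le b b'"
    then obtain C where C: "C \<in> Q" "b \<in> C" by blast
    obtain C' where C': "C' \<in> P" "b' \<in> C'" using contractionD(1)[OF P] h(2) by blast
    have CK: "\<Union>C \<in> K" using C(1) by (simp add: Q_def)
    have cq: "\<Union>C \<in> blocks q" "\<Union>C' \<in> blocks q" using C(1) C'(1) QP q by auto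
    note fin = block_finite[OF cq(1)] block_nonempty[OF cq(1)]
    obtain x where x: "x \<in> b'" using block_nonempty[OF h(2)] by blast
    have b: "b \<in> blocks \<pi>" using h(1) QY by blast
    have "b \<subseteq> \<Union>C" using C(2) by blast
    then have "Min (\<Union>C) \<le> Min b" "Max b \<le> Max (\<Union>C)"
      using Min_antimono[OF _ block_nonempty[OF b] fin(1)] Max_mono[OF _ block_nonempty[OF b] fin(1)] by blast+
    moreover have "x \<in> {Min b..Max b}" using h(3) x unfolding nest_le_def by blast
    ultimately have xx: "x \<in> {Min (\<Union>C)..Max (\<Union>C)}" by simp
    have "nest_le (\<Union>C) (\<Union>C')"
      by (rule nested_if_meets[OF blocks_noncrossing cq fin _ _ xx])
        (use block_eq[OF cq] x C'(2) in blast)+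
    then have "\<Union>C' \<in> K" by (rule idealD[OF K CK cq(2)])
    then show "b' \<in> \<Union>Q" using C' by (auto simp: Q_def)
  qed
  show "P - Q \<in> contractions (blocks \<pi> - \<Union>Q)"
  proof (rule contractionI)
    show "\<Union>(P - Q) = blocks \<pi> - \<Union>Q"
    proof (intro set_eqI iffI)
      fix b assume "b \<in> \<Union>(P - Q)"
      then obtain C where C: "C \<in> P" "C \<notin> Q" "b \<in> C" by blast
      then have "b \<notin> \<Union>Q" using contractionD(4)[OF P] QP by blast
      then show "b \<in> blocks \<pi> - \<Union>Q" using C contractionD(1)[OF P] by blast
    next
      fix b assume "b \<in> blocks \<pi> - \<Union>Q"
      then show "b \<in> \<Union>(P - Q)" using contractionD(1)[OF P] by blast
    qed
    show "noncrossing (Union ` (P - Q))" by (rule noncrossing_subset[OF contractionD(3)[OF P]]) blast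
  qed (use contractionD(2,4)[OF P] in blast)+
  have "Q \<in> contractions (\<Union>Q)"
  proof (rule contractionI)
    show "noncrossing (Union ` Q)" by (rule noncrossing_subset[OF contractionD(3)[OF P]]) (use QP in blast)
  qed (use contractionD(2,4)[OF P] QP in blast)+
  moreover have "\<exists>I\<in>segments (\<Union>(\<Union>Q)). \<Union>C \<subseteq> I" if "C \<in> Q" for C
    unfolding UUQ by (rule ideal_block_in_segment[OF K]) (use that in \<open>simp add: Q_def\<close>)
  ultimately show "Q \<in> seg_contractions (\<Union>Q)" by (simp add: seg_contractions_def)
qed

text \<open>The other half. The union of the two contractions is noncrossing since the range of a class of
\<open>Q\<close> stays inside a segment of \<open>J\<close>, which contains no element of the classes of \<open>P\<close>.\<close>

lemma glue_contraction:
  assumes J: "J \<in> ideals \<pi>" and P: "P \<in> contractions (blocks \<pi> - J)" and Q: "Q \<in> seg_contractions J"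
  shows "P \<union> Q \<in> contractions (blocks \<pi>)" "\<And>q. blocks q = Union ` (P \<union> Q) \<Longrightarrow> Union ` Q \<in> ideals q"
    "{C \<in> P \<union> Q. \<Union>C \<in> Union ` Q} = Q" "P \<inter> Q = {}"
    "Union ` (P \<union> Q) - Union ` Q = Union ` P"
proof -
  have JY: "J \<subseteq> blocks \<pi>" by (rule ideal_subset[OF J])
  have QE: "Q \<in> contractions J" using Q by (simp add: seg_contractions_def)
  have seg: "\<exists>I\<in>segments (\<Union>J). \<Union>C \<subseteq> I" if "C \<in> Q" for C using Q that by (simp add: seg_contractions_def)
  have UQ: "\<Union>C \<subseteq> \<Union>J" if "C \<in> Q" for C using contractionD(1)[OF QE] that by blast
  have UP: "x \<notin> \<Union>J" if Cx: "C \<in> P" "x \<in> \<Union>C" for C x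
  proof
    assume "x \<in> \<Union>J"
    then obtain b where b: "x \<in> b" "b \<in> J" by blast
    obtain c where c: "x \<in> c" "c \<in> C" using Cx(2) by blast
    have "c \<in> blocks \<pi> - J" using contractionD(1)[OF P] c Cx(1) by blast
    then show False using block_eq[of b \<pi> c x] b c JY by blast
  qed
  have dis: "\<Union>C \<noteq> \<Union>D" if CD: "C \<in> P" "D \<in> Q" for C D
  proof
    assume "\<Union>C = \<Union>D"
    moreover obtain b x where "b \<in> C" "x \<in> b" by (rule class_element[OF _ P CD(1)]) blast
    ultimately show False using UP[OF CD(1), of x] UQ[OF CD(2)] by blast
  qed
  show PQ: "P \<inter> Q = {}" using dis by blast
  show split: "{C \<in> P \<union> Q. \<Union>C \<in> Union ` Q} = Q" using dis by blast
  show "Union ` (P \<union> Q) - Union ` Q = Union ` P" using dis by blast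
  \<comment> \<open>Two points of a class of \<open>Q\<close> lie in one segment, which also contains everything between them.\<close>
  have nocross: False if "C \<in> P" "D \<in> Q" "x \<in> \<Union>D" "z \<in> \<Union>D" "y \<in> \<Union>C" "x < y" "y < z" for C D x y z
  proof -
    obtain I where I: "I \<in> segments (\<Union>J)" "\<Union>D \<subseteq> I" using seg[OF \<open>D \<in> Q\<close>] by blast
    have "y \<in> I" by (rule segment_convex[OF I(1), of x z]) (use I(2) that in auto)
    then show False using segmentsD(2)[OF I(1)] UP that by blast
  qed
  show "P \<union> Q \<in> contractions (blocks \<pi>)"
  proof (rule contractionI)
    show "\<Union>(P \<union> Q) = blocks \<pi>" using contractionD(1)[OF P] contractionD(1)[OF QE] JY by blast
    show "{} \<notin> P \<union> Q" using contractionD(2)[OF P] contractionD(2)[OF QE] by blast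
    show "C = D" if "C \<in> P \<union> Q" "D \<in> P \<union> Q" "b \<in> C" "b \<in> D" for C D b
      using contractionD(4)[OF P, of C D b] contractionD(4)[OF QE, of C D b] contractionD(1)[OF P] contractionD(1)[OF QE] that by blast
    show "noncrossing (Union ` (P \<union> Q))"
    proof (rule noncrossingI)
      fix c d x y z t
      assume cd: "c \<in> Union ` (P \<union> Q)" "d \<in> Union ` (P \<union> Q)"
        and h: "x \<in> c" "y \<in> d" "z \<in> c" "t \<in> d" "x < y" "y < z" "z < t"
      obtain C D where CD: "C \<in> P \<union> Q" "D \<in> P \<union> Q" "c = \<Union>C" "d = \<Union>D" using cd by blast
      consider "C \<in> P" "D \<in> P" | "C \<in> Q" "D \<in> Q" | "C \<in> P" "D \<in> Q" | "C \<in> Q" "D \<in> P"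
        using CD by blast
      then show "c = d"
      proof cases
        case 1
        then show ?thesis using noncrossingD[OF contractionD(3)[OF P] _ _ h] CD(3,4) by blast
      next
        case 2
        then show ?thesis using noncrossingD[OF contractionD(3)[OF QE] _ _ h] CD(3,4) by blast
      next
        case 3
        then show ?thesis using nocross[OF 3, of y t z] h CD(3,4) by simp
      next
        case 4
        then show ?thesis using nocross[OF 4(2,1), of x z y] h CD(3,4) by simp
      qed
    qed
  qed
  show "Union ` Q \<in> ideals q" if q: "blocks q = Union ` (P \<union> Q)" for q
    unfolding ideals_def mem_Collect_eq
  proof (intro conjI ballI impI)
    show "Union ` Q \<subseteq> blocks q" unfolding q by blast
    fix d c assume h: "d \<in> Union ` Q" "c \<in> blocks q" "nest_le d c"
    obtain D where D: "D \<in> Q" "d = \<Union>D" using h(1) by blast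
    obtain C where C: "C \<in> P \<union> Q" "c = \<Union>C" using h(2) q by blast
    have dq: "d \<in> blocks q" using h(1) q by blast
    have mm: "Min d \<in> d" "Max d \<in> d" using block_finite[OF dq] block_nonempty[OF dq] by simp_all
    obtain I where I: "I \<in> segments (\<Union>J)" "\<Union>D \<subseteq> I" using seg D(1) by blast
    obtain x where x: "x \<in> c" using block_nonempty[OF h(2)] by blast
    then have "x \<in> {Min d..Max d}" using h(3) unfolding nest_le_def by blast
    then have "x \<in> I" using segment_convex[OF I(1), of "Min d" "Max d" x] mm I(2) D(2) by auto
    then have "x \<in> \<Union>J" using segmentsD(2)[OF I(1)] by blast
    then have "C \<notin> P" using UP x C(2) by blast
    then show "c \<in> Union ` Q" using C by blast
  qed
qed

text \<open>Expanding the product over the segments yields families of contractions of the segments, and the union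
of such a family is a contraction of \<open>J\<close>. It is noncrossing since segments are disjoint intervals.\<close>

lemma prod_segments_star:
  assumes J: "J \<in> ideals \<pi>"
  shows "(\<Sum>Q\<in>seg_contractions J. (\<Prod>I\<in>segments (\<Union>J). hat g (Union ` {C \<in> Q. \<Union>C \<subseteq> I})) * (\<Prod>C\<in>Q. hat h C)) =
    (\<Prod>I\<in>segments (\<Union>J). star_on g h {b \<in> J. b \<subseteq> I})"
proof -
  let ?S = "segments (\<Union>J)" and ?J = "\<lambda>I. {b \<in> J. b \<subseteq> I}"
  have JY: "J \<subseteq> blocks \<pi>" by (rule ideal_subset[OF J])
  have finJ: "finite J" using finite_subset[OF JY finite_blocks] .
  have finS: "finite ?S" by (rule finite_segments[OF finite_Union_blocks[OF JY]])
  have sub: "?J I \<subseteq> blocks \<pi>" for I using JY by blast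
  have classI: "\<Union>C \<subseteq> I" if "Q \<in> contractions (?J I)" "C \<in> Q" for Q C I
    using contractionD(1)[OF that(1)] that(2) by blast
  have same: "I = I'" if Q: "Q \<in> contractions (?J I)" "C \<in> Q" "\<Union>C \<subseteq> I'" "I \<in> ?S" "I' \<in> ?S" for Q C I I'
  proof -
    obtain b x where "b \<in> C" "x \<in> b" by (rule class_element[OF sub Q(1,2)])
    then show ?thesis using classI[OF Q(1,2)] Q(3) segments_disjoint[OF Q(4,5), of x] by blast
  qed
  have "(\<Prod>I\<in>?S. star_on g h (?J I)) =
     (\<Sum>G\<in>PiE ?S (\<lambda>I. contractions (?J I)). \<Prod>I\<in>?S. hat g (Union ` G I) * (\<Prod>C\<in>G I. hat h C))"
    unfolding star_on_def by (rule prod_sum_PiE[OF finS]) (use finJ in simp)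
  also have "\<dots> = (\<Sum>Q\<in>seg_contractions J. (\<Prod>I\<in>?S. hat g (Union ` {C \<in> Q. \<Union>C \<subseteq> I})) * (\<Prod>C\<in>Q. hat h C))"
  proof (rule sum.reindex_bij_witness[where j = "\<lambda>G. \<Union>I\<in>?S. G I"
        and i = "\<lambda>Q. restrict (\<lambda>I. {C \<in> Q. \<Union>C \<subseteq> I}) ?S"])
    fix G assume G: "G \<in> PiE ?S (\<lambda>I. contractions (?J I))"
    then have GI: "G I \<in> contractions (?J I)" if "I \<in> ?S" for I using that by (rule PiE_mem)
    let ?Q = "\<Union>I\<in>?S. G I"
    have part: "{C \<in> ?Q. \<Union>C \<subseteq> I} = G I" if I: "I \<in> ?S" for I
    proof (intro set_eqI iffI)
      fix C assume "C \<in> {C \<in> ?Q. \<Union>C \<subseteq> I}"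
      then obtain I' where I': "I' \<in> ?S" "C \<in> G I'" "\<Union>C \<subseteq> I" by blast
      then have "I' = I" using same[OF GI[OF I'(1)] I'(2,3) I'(1) I] by blast
      then show "C \<in> G I" using I'(2) by simp
    next
      fix C assume "C \<in> G I"
      then show "C \<in> {C \<in> ?Q. \<Union>C \<subseteq> I}" using classI[OF GI[OF I]] I by blast
    qed
    show "restrict (\<lambda>I. {C \<in> ?Q. \<Union>C \<subseteq> I}) ?S = G"
      using PiE_restrict[OF G] part by (metis (no_types, lifting) restrict_ext)
    have "?Q \<in> contractions J"
    proof (rule contractionI)
      show "\<Union>?Q = J"
      proof (intro set_eqI iffI)
        fix b assume "b \<in> \<Union>?Q"
        then obtain I C where "I \<in> ?S" "C \<in> G I" "b \<in> C" by blast
        then show "b \<in> J" using contractionD(1)[OF GI[of I]] by blast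
      next
        fix b assume b: "b \<in> J"
        then obtain I where I: "I \<in> ?S" "b \<subseteq> I" using ideal_block_in_segment[OF J] by blast
        then have "b \<in> \<Union>(G I)" using contractionD(1)[OF GI[OF I(1)]] b by blast
        then show "b \<in> \<Union>?Q" using I(1) by blast
      qed
      show "{} \<notin> ?Q" using contractionD(2)[OF GI] by blast
      \<comment> \<open>Segments are convex, so a point between two points of a class lies in the segment of that class.\<close>
      have common: "\<exists>I\<in>?S. C \<in> G I \<and> D \<in> G I"
        if h: "C \<in> ?Q" "D \<in> ?Q" "x \<in> \<Union>C" "z \<in> \<Union>C" "y \<in> \<Union>D" "x \<le> y" "y \<le> z" for C D x y z
      proof -
        obtain I I' where I: "I \<in> ?S" "C \<in> G I" "I' \<in> ?S" "D \<in> G I'" using h(1,2) by blast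
        have "y \<in> I" by (rule segment_convex[OF I(1), of x z])
            (use classI[OF GI[OF I(1)] I(2)] h in auto)
        moreover have "y \<in> I'" using classI[OF GI[OF I(3)] I(4)] h(5) by blast
        ultimately have "I = I'" using segments_disjoint[OF I(1,3)] by blast
        then show ?thesis using I by blast
      qed
      show "C = D" if CD: "C \<in> ?Q" "D \<in> ?Q" "b \<in> C" "b \<in> D" for C D b
      proof -
        obtain I where I: "I \<in> ?S" "C \<in> G I" using CD(1) by blast
        have "b \<in> blocks \<pi>" using contractionD(1)[OF GI[OF I(1)]] I(2) CD(3) JY by blast
        then obtain x where x: "x \<in> b" using block_nonempty by blast
        obtain I where I: "I \<in> ?S" "C \<in> G I" "D \<in> G I" using common[OF CD(1,2), of x x x] CD(3,4) x by blast
        then show ?thesis using contractionD(4)[OF GI[OF I(1)] I(2,3) CD(3,4)] by blast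
      qed
      show "noncrossing (Union ` ?Q)"
      proof (rule noncrossingI)
        fix c d x y z t
        assume cd: "c \<in> Union ` ?Q" "d \<in> Union ` ?Q"
          and h: "x \<in> c" "y \<in> d" "z \<in> c" "t \<in> d" "x < y" "y < z" "z < t"
        obtain C D where CD: "C \<in> ?Q" "D \<in> ?Q" "c = \<Union>C" "d = \<Union>D" using cd by blast
        obtain I where I: "I \<in> ?S" "C \<in> G I" "D \<in> G I"
          using common[OF CD(1,2), of x z y] h CD(3,4) by auto
        then show "c = d" using noncrossingD[OF contractionD(3)[OF GI[OF I(1)]] _ _ h] CD(3,4) by blast
      qed
    qed
    then show "?Q \<in> seg_contractions J" unfolding seg_contractions_def using classI[OF GI] by blast
    have fin: "finite (G I)" if "I \<in> ?S" for I by (rule contraction_finite[OF _ GI[OF that]]) (use finJ in simp)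
    have "(\<Prod>C\<in>?Q. hat h C) = (\<Prod>I\<in>?S. \<Prod>C\<in>G I. hat h C)"
    proof (rule prod.UNION_disjoint[OF finS])
      show "\<forall>I\<in>?S. \<forall>I'\<in>?S. I \<noteq> I' \<longrightarrow> G I \<inter> G I' = {}"
      proof (intro ballI impI)
        fix I I' assume I: "I \<in> ?S" "I' \<in> ?S" "I \<noteq> I'"
        show "G I \<inter> G I' = {}"
        proof (rule ccontr)
          assume "G I \<inter> G I' \<noteq> {}"
          then obtain C where C: "C \<in> G I" "C \<in> G I'" by blast
          then show False using same[OF GI[OF I(1)] C(1) classI[OF GI[OF I(2)] C(2)] I(1,2)] I(3) by blast
        qed
      qed
    qed (use fin in blast)
    moreover have "(\<Prod>I\<in>?S. hat g (Union ` {C \<in> ?Q. \<Union>C \<subseteq> I})) = (\<Prod>I\<in>?S. hat g (Union ` G I))"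
      by (rule prod.cong[OF refl]) (simp only: part)
    ultimately show "(\<Prod>I\<in>?S. hat g (Union ` {C \<in> ?Q. \<Union>C \<subseteq> I})) * (\<Prod>C\<in>?Q. hat h C) =
        (\<Prod>I\<in>?S. hat g (Union ` G I) * (\<Prod>C\<in>G I. hat h C))"
      by (simp only: prod.distrib)
  next
    fix Q assume Q: "Q \<in> seg_contractions J"
    then have QE: "Q \<in> contractions J" and seg: "\<And>C. C \<in> Q \<Longrightarrow> \<exists>I\<in>?S. \<Union>C \<subseteq> I" by (auto simp: seg_contractions_def)
    have "(\<Union>I\<in>?S. {C \<in> Q. \<Union>C \<subseteq> I}) = Q" using seg by blast
    then show "(\<Union>I\<in>?S. restrict (\<lambda>I. {C \<in> Q. \<Union>C \<subseteq> I}) ?S I) = Q" by simp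
    have "{C \<in> Q. \<Union>C \<subseteq> I} \<in> contractions (?J I)" if I: "I \<in> ?S" for I
    proof (rule contractionI)
      show "\<Union>{C \<in> Q. \<Union>C \<subseteq> I} = ?J I"
      proof (intro set_eqI iffI)
        fix b assume "b \<in> \<Union>{C \<in> Q. \<Union>C \<subseteq> I}"
        then show "b \<in> ?J I" using contractionD(1)[OF QE] by blast
      next
        fix b assume b: "b \<in> ?J I"
        then obtain C where C: "C \<in> Q" "b \<in> C" using contractionD(1)[OF QE] by blast
        obtain I' where I': "I' \<in> ?S" "\<Union>C \<subseteq> I'" using seg[OF C(1)] by blast
        obtain x where x: "x \<in> b" using block_nonempty b JY by blast
        have "I' = I" by (rule segments_disjoint[OF I'(1) I, of x]) (use x b C I' in blast)+
        then show "b \<in> \<Union>{C \<in> Q. \<Union>C \<subseteq> I}" using C I' by blast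
      qed
      show "noncrossing (Union ` {C \<in> Q. \<Union>C \<subseteq> I})"
        by (rule noncrossing_subset[OF contractionD(3)[OF QE]]) blast
    qed (use contractionD(2,4)[OF QE] in blast)+
    then show "restrict (\<lambda>I. {C \<in> Q. \<Union>C \<subseteq> I}) ?S \<in> PiE ?S (\<lambda>I. contractions (?J I))" by simp
  qed
  finally show ?thesis ..
qed

text \<open>Both sides are sums over triples of an ideal \<open>J\<close> of \<open>\<pi>\<close>, a contraction of its complement and a
contraction inside the segments of \<open>J\<close>. On the left they come as a contraction \<open>P\<close> of \<open>\<pi>\<close> with an ideal
\<open>K\<close> of the quotient. The set \<open>J\<close> of blocks inside \<open>K\<close> has the same union as \<open>K\<close>, so the segments agree.\<close>

lemma star_distributes_over_conv:
  "star_fn (conv_fn f g) h = conv_fn (star_fn f h) (star_fn g h)"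
proof
  fix \<pi>
  let ?Y = "blocks \<pi>"
  let ?ideals = "\<lambda>Z. {J. J \<subseteq> Z \<and> (\<forall>b\<in>J. \<forall>b'\<in>Z. nest_le b b' \<longrightarrow> b' \<in> J)}"
  have ideals: "?ideals Z = ideals q" if "blocks q = Z" for q Z using that by (simp add: ideals_def)
  \<comment> \<open>The summands for a contraction with an ideal of the quotient, and for a triple.\<close>
  define t where "t P K = hat f (Union ` P - K) * (\<Prod>I\<in>segments (\<Union>K). hat g {c \<in> K. c \<subseteq> I}) *
     (\<Prod>C\<in>P. hat h C)" for P K
  define s where "s J P Q = (hat f (Union ` P) * (\<Prod>C\<in>P. hat h C)) *
     ((\<Prod>I\<in>segments (\<Union>J). hat g (Union ` {C \<in> Q. \<Union>C \<subseteq> I})) * (\<Prod>C\<in>Q. hat h C))" for J P Q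
  have "star_fn (conv_fn f g) h \<pi> = (\<Sum>P\<in>contractions ?Y. \<Sum>K\<in>?ideals (Union ` P). t P K)"
    unfolding star_fn_def star_on_def
  proof (rule sum.cong[OF refl])
    fix P assume P: "P \<in> contractions ?Y"
    obtain q where q: "blocks q = Union ` P" using contraction_quotient[OF P] by (elim exE)
    show "hat (conv_fn f g) (Union ` P) * (\<Prod>C\<in>P. hat h C) = (\<Sum>K\<in>?ideals (Union ` P). t P K)"
      unfolding hat_eq[OF q] conv_fn_def ideals[OF q] q sum_distrib_right t_def ..
  qed
  also have "\<dots> = (\<Sum>(P, K)\<in>(SIGMA P:contractions ?Y. ?ideals (Union ` P)). t P K)"
  proof (rule sum.Sigma)
    show "finite (contractions ?Y)" by simp
    show "\<forall>P\<in>contractions ?Y. finite (?ideals (Union ` P))"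
    proof
      fix P assume "P \<in> contractions ?Y"
      then have "finite (Union ` P)" using contraction_finite[OF finite_blocks] by blast
      then show "finite (?ideals (Union ` P))" by (auto intro: finite_subset[of _ "Pow (Union ` P)"])
    qed
  qed
  also have "\<dots> = (\<Sum>(J, P, Q)\<in>(SIGMA J:ideals \<pi>. contractions (?Y - J) \<times> seg_contractions J). s J P Q)"
  proof (rule sum.reindex_bij_witness[where
        j = "\<lambda>(P, K). let Q = {C \<in> P. \<Union>C \<in> K} in (\<Union>Q, P - Q, Q)" and
        i = "\<lambda>(J, P, Q). (P \<union> Q, Union ` Q)"])
    fix a assume "a \<in> (SIGMA P:contractions ?Y. ?ideals (Union ` P))"
    then obtain P K where a: "a = (P, K)" "P \<in> contractions ?Y" "K \<in> ?ideals (Union ` P)" by blast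
    obtain q where q: "blocks q = Union ` P" using contraction_quotient[OF a(2)] by (elim exE)
    have K: "K \<in> ideals q" using a(3) unfolding ideals[OF q] .
    define Q where "Q = {C \<in> P. \<Union>C \<in> K}"
    note split = split_contraction[OF a(2) q K, folded Q_def]
    have PQ: "(P - Q) \<union> Q = P" by (auto simp: Q_def)
    show "(case case a of (P, K) \<Rightarrow> let Q = {C \<in> P. \<Union>C \<in> K} in (\<Union>Q, P - Q, Q) of
        (J, P, Q) \<Rightarrow> (P \<union> Q, Union ` Q)) = a"
      unfolding a(1) using PQ split(4) by (simp add: Let_def flip: Q_def)
    show "(case a of (P, K) \<Rightarrow> let Q = {C \<in> P. \<Union>C \<in> K} in (\<Union>Q, P - Q, Q)) \<in>
        (SIGMA J:ideals \<pi>. contractions (?Y - J) \<times> seg_contractions J)"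
      unfolding a(1) using split(1-3) by (simp add: Let_def flip: Q_def)
    have U: "Union ` P - K = Union ` (P - Q)"
      using glue_contraction(5)[OF split(1-3)] unfolding PQ split(4) .
    have UK: "\<Union>(\<Union>Q) = \<Union>K" unfolding split(4)[symmetric] by blast
    have seg: "{c \<in> K. c \<subseteq> I} = Union ` {C \<in> Q. \<Union>C \<subseteq> I}" for I
      unfolding split(4)[symmetric] by blast
    have "(\<Prod>C\<in>P. hat h C) = (\<Prod>C\<in>P - Q. hat h C) * (\<Prod>C\<in>Q. hat h C)"
      using prod.subset_diff[of Q P "hat h"] contraction_finite[OF finite_blocks a(2)] by (auto simp: Q_def)
    then have "s (\<Union>Q) (P - Q) Q = t P K"
      unfolding s_def t_def U UK seg by (simp add: mult_ac)
    then show "(case case a of (P, K) \<Rightarrow> let Q = {C \<in> P. \<Union>C \<in> K} in (\<Union>Q, P - Q, Q) of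
        (J, P, Q) \<Rightarrow> s J P Q) = (case a of (P, K) \<Rightarrow> t P K)"
      unfolding a(1) by (simp add: Let_def flip: Q_def)
  next
    fix a assume "a \<in> (SIGMA J:ideals \<pi>. contractions (?Y - J) \<times> seg_contractions J)"
    then obtain J P Q where a: "a = (J, P, Q)" "J \<in> ideals \<pi>" "P \<in> contractions (?Y - J)" "Q \<in> seg_contractions J" by blast
    note glue = glue_contraction[OF a(2-4)]
    have UQ: "\<Union>Q = J" using a(4) by (auto simp: seg_contractions_def contractionD(1))
    have PQ: "P \<union> Q - Q = P" using glue(4) by blast
    show "(case case a of (J, P, Q) \<Rightarrow> (P \<union> Q, Union ` Q) of
        (P, K) \<Rightarrow> let Q = {C \<in> P. \<Union>C \<in> K} in (\<Union>Q, P - Q, Q)) = a"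
      unfolding a(1) prod.case Let_def glue(3) UQ PQ ..
    obtain q where q: "blocks q = Union ` (P \<union> Q)" using contraction_quotient[OF glue(1)] by (elim exE)
    have "Union ` Q \<in> ?ideals (Union ` (P \<union> Q))" unfolding ideals[OF q] by (rule glue(2)[OF q])
    then show "(case a of (J, P, Q) \<Rightarrow> (P \<union> Q, Union ` Q)) \<in> (SIGMA P:contractions ?Y. ?ideals (Union ` P))"
      unfolding a(1) prod.case using glue(1) by blast
  qed
  also have "\<dots> = (\<Sum>J\<in>ideals \<pi>. \<Sum>(P, Q)\<in>contractions (?Y - J) \<times> seg_contractions J. s J P Q)"
  proof (rule sum.Sigma[symmetric])
    show "\<forall>J\<in>ideals \<pi>. finite (contractions (?Y - J) \<times> seg_contractions J)"
    proof
      fix J assume "J \<in> ideals \<pi>"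
      then have "finite J" using ideal_subset finite_subset finite_blocks by metis
      then show "finite (contractions (?Y - J) \<times> seg_contractions J)" by (simp add: seg_contractions_def)
    qed
  qed simp
  also have "\<dots> = conv_fn (star_fn f h) (star_fn g h) \<pi>"
    unfolding conv_fn_def
  proof (rule sum.cong[OF refl])
    fix J assume J: "J \<in> ideals \<pi>"
    have sub: "{b \<in> J. b \<subseteq> I} \<subseteq> ?Y" for I using ideal_subset[OF J] by blast
    have "(\<Sum>(P, Q)\<in>contractions (?Y - J) \<times> seg_contractions J. s J P Q) =
      star_on f h (?Y - J) * (\<Prod>I\<in>segments (\<Union>J). star_on g h {b \<in> J. b \<subseteq> I})"
      unfolding prod_segments_star[OF J, symmetric] star_on_def[of f h] s_def
      by (simp add: sum_product sum.cartesian_product)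
    then show "(\<Sum>(P, Q)\<in>contractions (?Y - J) \<times> seg_contractions J. s J P Q) = hat (star_fn f h) (?Y - J) *
        (\<Prod>I\<in>segments (\<Union>J). hat (star_fn g h) {b \<in> J. b \<subseteq> I})"
      by (simp add: hat_star_fn[OF sub] hat_star_fn[OF Diff_subset])
  qed
  finally show "star_fn (conv_fn f g) h \<pi> = conv_fn (star_fn f h) (star_fn g h) \<pi>" .
qed

section \<open>Weights of finite relations\<close>

text \<open>Linear extensions of an arbitrary relation on a set. Their number satisfies a recursion over the
maximal elements, from which all identities below follow by induction.\<close>

definition lin_ext :: "('a \<Rightarrow> 'a \<Rightarrow> bool) \<Rightarrow> 'a set \<Rightarrow> ('a \<Rightarrow> nat) set" where
  "lin_ext R S = {f \<in> S \<rightarrow>\<^sub>E {1..card S}. bij_betw f S {1..card S} \<and>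
     (\<forall>b\<in>S. \<forall>b'\<in>S. R b b' \<longrightarrow> f b \<le> f b')}"

definition maximals :: "('a \<Rightarrow> 'a \<Rightarrow> bool) \<Rightarrow> 'a set \<Rightarrow> 'a set" where
  "maximals R S = {m \<in> S. \<forall>b\<in>S. R m b \<longrightarrow> b = m}"

lemma finite_lin_ext: "finite S \<Longrightarrow> finite (lin_ext R S)"
  by (rule finite_subset[of _ "S \<rightarrow>\<^sub>E {1..card S}"]) (auto simp: lin_ext_def intro: finite_PiE)

lemma finite_maximals: "finite S \<Longrightarrow> finite (maximals R S)"
  by (simp add: maximals_def)

lemma lin_ext_empty: "lin_ext R {} = {\<lambda>x. undefined}"
  by (auto simp: lin_ext_def bij_betw_def)

lemma lin_ext_remove_top:
  assumes S: "finite S" and f: "f \<in> lin_ext R S" and m: "m \<in> S" "f m = card S"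
  shows "m \<in> maximals R S" "f(m := undefined) \<in> lin_ext R (S - {m})"
proof -
  have PE: "f \<in> S \<rightarrow>\<^sub>E {1..card S}" and bij: "bij_betw f S {1..card S}"
    and mono: "\<And>b b'. b \<in> S \<Longrightarrow> b' \<in> S \<Longrightarrow> R b b' \<Longrightarrow> f b \<le> f b'"
    using f by (auto simp: lin_ext_def)
  have inj: "inj_on f S" using bij by (rule bij_betw_imp_inj_on)
  have le: "f b \<le> card S" if "b \<in> S" for b using PiE_mem[OF PE that] by simp
  show "m \<in> maximals R S"
    unfolding maximals_def
  proof (intro CollectI conjI ballI impI m(1))
    fix b assume b: "b \<in> S" "R m b"
    have "f b = f m" using mono[OF m(1) b] le[OF b(1)] m(2) by simp
    then show "b = m" using inj b(1) m(1) by (simp add: inj_on_eq_iff)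
  qed
  have card: "card (S - {m}) = card S - 1" using S m(1) by simp
  have img: "f ` (S - {m}) = {1..card S - 1}"
  proof -
    have "f ` (S - {m}) = f ` S - {f m}" using inj m(1) by (auto simp: inj_on_eq_iff)
    also have "\<dots> = {1..card S - 1}" using bij m(2) by (auto simp: bij_betw_def)
    finally show ?thesis .
  qed
  let ?g = "f(m := undefined)"
  have g: "?g b = f b" if "b \<in> S - {m}" for b using that by simp
  have "bij_betw f (S - {m}) {1..card S - 1}"
    unfolding bij_betw_def using img inj_on_subset[OF inj] by blast
  then have "bij_betw ?g (S - {m}) {1..card (S - {m})}"
    unfolding card using bij_betw_cong[of "S - {m}" ?g f] g by blast
  moreover have "?g \<in> (S - {m}) \<rightarrow>\<^sub>E {1..card (S - {m})}"
  proof (rule PiE_I)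
    show "?g b \<in> {1..card (S - {m})}" if "b \<in> S - {m}" for b
      unfolding card g[OF that] img[symmetric] using that by (rule imageI)
    show "?g b = undefined" if "b \<notin> S - {m}" for b
      using that PiE_arb[OF PE, of b] by (cases "b = m") simp_all
  qed
  ultimately show "?g \<in> lin_ext R (S - {m})"
    unfolding lin_ext_def using mono by simp
qed

lemma lin_ext_add_top:
  assumes S: "finite S" and m: "m \<in> maximals R S" and g: "g \<in> lin_ext R (S - {m})"
  shows "g(m := card S) \<in> lin_ext R S"
proof -
  have mS: "m \<in> S" and max: "\<And>b. b \<in> S \<Longrightarrow> R m b \<Longrightarrow> b = m" using m by (auto simp: maximals_def)
  have card: "card (S - {m}) = card S - 1" "card S > 0" using S mS by (auto simp: card_gt_0_iff)
  have PE: "g \<in> (S - {m}) \<rightarrow>\<^sub>E {1..card S - 1}" and bij: "bij_betw g (S - {m}) {1..card S - 1}"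
    and mono: "\<And>b b'. b \<in> S - {m} \<Longrightarrow> b' \<in> S - {m} \<Longrightarrow> R b b' \<Longrightarrow> g b \<le> g b'"
    using g unfolding lin_ext_def card(1) by blast+
  have le: "g b \<in> {1..card S - 1}" if "b \<in> S - {m}" for b by (rule PiE_mem[OF PE that])
  let ?f = "g(m := card S)"
  have f: "?f b = g b" if "b \<in> S - {m}" for b using that by simp
  have "bij_betw ?f (S - {m}) {1..card S - 1}"
    using bij bij_betw_cong[of "S - {m}" ?f g] f by blast
  then have "bij_betw ?f (insert m (S - {m})) (insert (card S) {1..card S - 1})"
    using notIn_Un_bij_betw3[of m "S - {m}" ?f "{1..card S - 1}"] card(2) by simp
  moreover have "insert m (S - {m}) = S" using mS by blast
  moreover have "insert (card S) {1..card S - 1} = {1..card S}" using card(2) by auto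
  ultimately have B: "bij_betw ?f S {1..card S}" by simp
  moreover have "?f \<in> S \<rightarrow>\<^sub>E {1..card S}"
  proof (rule PiE_I)
    show "?f b \<in> {1..card S}" if "b \<in> S" for b using bij_betwE[OF B] that by blast
    show "?f b = undefined" if "b \<notin> S" for b
      using that mS PiE_arb[OF PE, of b] by (cases "b = m") simp_all
  qed
  moreover have "?f b \<le> ?f b'" if h: "b \<in> S" "b' \<in> S" "R b b'" for b b'
  proof (cases "b' = m")
    case True
    then show ?thesis using bij_betwE[OF B] h(1) by auto
  next
    case False
    then have "b \<noteq> m" using max[OF h(2)] h(3) by blast
    then show ?thesis using False mono[of b b'] h by simp
  qed
  ultimately show ?thesis unfolding lin_ext_def by blast
qed

text \<open>The element with the largest label is maximal; removing it is inverse to adding a maximal element on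
top.\<close>

lemma card_lin_ext_rec:
  assumes S: "finite S" "S \<noteq> {}"
  shows "card (lin_ext R S) = (\<Sum>m\<in>maximals R S. card (lin_ext R (S - {m})))"
proof -
  have pos: "card S > 0" using S by (simp add: card_gt_0_iff)
  define top where "top f = inv_into S f (card S)" for f :: "'a \<Rightarrow> nat"
  have top: "top f \<in> S" "f (top f) = card S" if "f \<in> lin_ext R S" for f
  proof -
    have "f ` S = {1..card S}" using that by (simp add: lin_ext_def bij_betw_def)
    then have "card S \<in> f ` S" using pos by simp
    then show "top f \<in> S" "f (top f) = card S" unfolding top_def by (rule inv_into_into, rule f_inv_into_f)
  qed
  have "bij_betw (\<lambda>f. (top f, f(top f := undefined))) (lin_ext R S)
     (SIGMA m:maximals R S. lin_ext R (S - {m}))"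
  proof (rule bij_betw_byWitness[where f' = "\<lambda>(m, g). g(m := card S)"])
    show "\<forall>f\<in>lin_ext R S. (\<lambda>(m, g). g(m := card S)) (top f, f(top f := undefined)) = f"
    proof
      fix f assume "f \<in> lin_ext R S"
      then have "f(top f := card S) = f" using top(2) by (metis fun_upd_triv)
      then show "(\<lambda>(m, g). g(m := card S)) (top f, f(top f := undefined)) = f" by simp
    qed
    show "\<forall>a\<in>SIGMA m:maximals R S. lin_ext R (S - {m}).
        (top ((\<lambda>(m, g). g(m := card S)) a),
         ((\<lambda>(m, g). g(m := card S)) a)(top ((\<lambda>(m, g). g(m := card S)) a) := undefined)) = a"
    proof
      fix a assume "a \<in> (SIGMA m:maximals R S. lin_ext R (S - {m}))"
      then obtain m g where a: "a = (m, g)" "m \<in> maximals R S" "g \<in> lin_ext R (S - {m})" by blast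
      have f: "g(m := card S) \<in> lin_ext R S" by (rule lin_ext_add_top[OF S(1) a(2,3)])
      have inj: "inj_on (g(m := card S)) S" using f unfolding lin_ext_def bij_betw_def by blast
      have mS: "m \<in> S" using a(2) by (simp add: maximals_def)
      have t: "top (g(m := card S)) = m"
        by (rule inj_onD[OF inj _ top(1)[OF f] mS], rule trans[OF top(2)[OF f]]) simp
      have "g \<in> (S - {m}) \<rightarrow>\<^sub>E {1..card (S - {m})}" using a(3) unfolding lin_ext_def by blast
      then have "g m = undefined" by (rule PiE_arb) simp
      then show "(top ((\<lambda>(m, g). g(m := card S)) a),
         ((\<lambda>(m, g). g(m := card S)) a)(top ((\<lambda>(m, g). g(m := card S)) a) := undefined)) = a"
        unfolding a(1) prod.case t by (simp add: fun_upd_idem)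
    qed
    show "(\<lambda>f. (top f, f(top f := undefined))) ` lin_ext R S \<subseteq> (SIGMA m:maximals R S. lin_ext R (S - {m}))"
      using lin_ext_remove_top[OF S(1)] top by blast
    show "(\<lambda>(m, g). g(m := card S)) ` (SIGMA m:maximals R S. lin_ext R (S - {m})) \<subseteq> lin_ext R S"
      using lin_ext_add_top[OF S(1)] by auto
  qed
  then have "card (lin_ext R S) = card (SIGMA m:maximals R S. lin_ext R (S - {m}))"
    by (rule bij_betw_same_card)
  also have "\<dots> = (\<Sum>m\<in>maximals R S. card (lin_ext R (S - {m})))"
    using finite_maximals[OF S(1)] S(1) by (simp add: finite_lin_ext)
  finally show ?thesis .
qed

lemma lin_ext_nonempty:
  assumes "finite S" "\<And>Z. Z \<subseteq> S \<Longrightarrow> Z \<noteq> {} \<Longrightarrow> maximals R Z \<noteq> {}"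
  shows "card (lin_ext R S) > 0"
  using assms
proof (induction S rule: finite_psubset_induct)
  case (psubset S)
  show ?case
  proof (cases "S = {}")
    case True
    then show ?thesis by (simp add: lin_ext_empty)
  next
    case False
    then obtain m where m: "m \<in> maximals R S" using psubset.prems[of S] by blast
    then have "S - {m} \<subset> S" by (auto simp: maximals_def)
    then have "card (lin_ext R (S - {m})) > 0"
    proof (rule psubset.IH)
      show "maximals R Z \<noteq> {}" if "Z \<subseteq> S - {m}" "Z \<noteq> {}" for Z
        by (rule psubset.prems[OF _ that(2)]) (use that(1) in blast)
    qed
    also have "card (lin_ext R (S - {m})) \<le> card (lin_ext R S)"
      unfolding card_lin_ext_rec[OF psubset.hyps(1) False]
      using m finite_maximals[OF psubset.hyps(1)] by (intro member_le_sum) auto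
    finally show ?thesis .
  qed
qed

text \<open>The proportion of linear extensions among all bijective labellings. In this normalization the weight
of a disjoint union without relations is a product, with no multinomial coefficient.\<close>

definition weight :: "('a \<Rightarrow> 'a \<Rightarrow> bool) \<Rightarrow> 'a set \<Rightarrow> 'k::field_char_0" where
  "weight R S = of_nat (card (lin_ext R S)) / fact (card S)"

lemma weight_empty [simp]: "weight R {} = 1"
  by (simp add: weight_def lin_ext_empty)

lemma weight_rec:
  assumes S: "finite S"
  shows "of_nat (card S) * weight R S = (\<Sum>m\<in>maximals R S. weight R (S - {m}))"
proof (cases "S = {}")
  case True
  then show ?thesis by (simp add: maximals_def)
next
  case False
  obtain n where n: "card S = Suc n" using S False by (metis card_0_eq not0_implies_Suc)
  have "card (S - {m}) = n" if "m \<in> maximals R S" for m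
    using that S n by (simp add: maximals_def)
  then have "(\<Sum>m\<in>maximals R S. weight R (S - {m})) =
      (\<Sum>m\<in>maximals R S. of_nat (card (lin_ext R (S - {m}))) / fact n)"
    by (simp add: weight_def)
  also have "\<dots> = of_nat (card (lin_ext R S)) / fact n"
    by (simp add: card_lin_ext_rec[OF S False] sum_divide_distrib)
  also have "\<dots> = of_nat (card S) * weight R S"
    by (simp add: weight_def n del: of_nat_Suc)
  finally show ?thesis ..
qed

lemma weight_image:
  assumes "finite S" "inj_on h S" "\<And>a b. a \<in> S \<Longrightarrow> b \<in> S \<Longrightarrow> R' (h a) (h b) \<longleftrightarrow> R a b"
  shows "weight R' (h ` S) = (weight R S :: 'k::field_char_0)"
  using assms
proof (induction S rule: finite_psubset_induct)
  case (psubset S)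
  let ?w = "weight R :: _ \<Rightarrow> 'k" and ?w' = "weight R' :: _ \<Rightarrow> 'k"
  have card: "card (h ` S) = card S" by (rule card_image[OF psubset.prems(1)])
  have max: "maximals R' (h ` S) = h ` maximals R S"
    using psubset.prems by (auto simp: maximals_def inj_on_eq_iff)
  have inj: "inj_on h (maximals R S)"
    by (rule inj_on_subset[OF psubset.prems(1)]) (auto simp: maximals_def)
  have "of_nat (card S) * ?w' (h ` S) = (\<Sum>m\<in>maximals R S. ?w' (h ` S - {h m}))"
    using weight_rec[of "h ` S" R'] psubset.hyps(1) by (simp add: card max sum.reindex[OF inj])
  also have "\<dots> = (\<Sum>m\<in>maximals R S. ?w (S - {m}))"
  proof (rule sum.cong[OF refl])
    fix m assume "m \<in> maximals R S"
    then have m: "m \<in> S" by (simp add: maximals_def)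
    then have "h ` S - {h m} = h ` (S - {m})" using psubset.prems(1) by (auto simp: inj_on_eq_iff)
    moreover have "inj_on h (S - {m})" by (rule inj_on_subset[OF psubset.prems(1)]) blast
    moreover have "S - {m} \<subset> S" using m by blast
    ultimately show "?w' (h ` S - {h m}) = ?w (S - {m})"
      using psubset.IH[of "S - {m}"] psubset.prems(2) by simp
  qed
  also have "\<dots> = of_nat (card S) * ?w S" by (rule weight_rec[OF psubset.hyps(1), symmetric])
  finally show ?case using psubset.hyps(1) by (cases "S = {}") auto
qed

definition unrelated :: "('a \<Rightarrow> 'a \<Rightarrow> bool) \<Rightarrow> 'a set \<Rightarrow> 'a set \<Rightarrow> bool" where
  "unrelated R A B \<longleftrightarrow> A \<inter> B = {} \<and> (\<forall>a\<in>A. \<forall>b\<in>B. \<not> R a b \<and> \<not> R b a)"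

text \<open>By induction: removing a maximal element of \<open>A \<union> B\<close> changes only one factor, so \<open>weight_rec\<close> gives
\<open>|A|\<close> and \<open>|B|\<close> times the product, and \<open>|A| + |B| = |S|\<close>.\<close>

lemma weight_Un:
  assumes "finite S" "S = A \<union> B" "unrelated R A B"
  shows "weight R S = (weight R A * weight R B :: 'k::field_char_0)"
  using assms
proof (induction S arbitrary: A B rule: finite_psubset_induct)
  case (psubset S)
  let ?w = "weight R :: _ \<Rightarrow> 'k"
  have AB: "finite A" "finite B" using psubset.hyps psubset.prems(1) by simp_all
  have dj: "A \<inter> B = {}" and un: "\<And>a b. a \<in> A \<Longrightarrow> b \<in> B \<Longrightarrow> \<not> R a b \<and> \<not> R b a"
    using psubset.prems(2) by (auto simp: unrelated_def)
  have max: "maximals R S = maximals R A \<union> maximals R B" "maximals R A \<inter> maximals R B = {}"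
    unfolding psubset.prems(1) maximals_def using dj un by blast+
  have A: "?w (S - {m}) = ?w (A - {m}) * ?w B" if "m \<in> maximals R A" for m
  proof (rule psubset.IH)
    have m: "m \<in> A" "m \<notin> B" using that dj by (auto simp: maximals_def)
    then show "S - {m} \<subset> S" "S - {m} = (A - {m}) \<union> B" using psubset.prems(1) by blast+
    show "unrelated R (A - {m}) B" using psubset.prems(2) unfolding unrelated_def by blast
  qed
  have B: "?w (S - {m}) = ?w A * ?w (B - {m})" if "m \<in> maximals R B" for m
  proof (rule psubset.IH)
    have m: "m \<in> B" "m \<notin> A" using that dj by (auto simp: maximals_def)
    then show "S - {m} \<subset> S" "S - {m} = A \<union> (B - {m})" using psubset.prems(1) by blast+
    show "unrelated R A (B - {m})" using psubset.prems(2) unfolding unrelated_def by blast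
  qed
  have "of_nat (card S) * ?w S =
      (\<Sum>m\<in>maximals R A. ?w (S - {m})) + (\<Sum>m\<in>maximals R B. ?w (S - {m}))"
    unfolding weight_rec[OF psubset.hyps(1)] max(1)
    by (rule sum.union_disjoint[OF finite_maximals[OF AB(1)] finite_maximals[OF AB(2)] max(2)])
  also have "\<dots> = (\<Sum>m\<in>maximals R A. ?w (A - {m})) * ?w B +
      ?w A * (\<Sum>m\<in>maximals R B. ?w (B - {m}))"
    by (simp add: A B sum_distrib_left sum_distrib_right)
  also have "\<dots> = of_nat (card A + card B) * (?w A * ?w B)"
    by (simp add: weight_rec[OF AB(1), symmetric] weight_rec[OF AB(2), symmetric] algebra_simps)
  also have "card A + card B = card S"
    using card_Un_disjoint[OF AB dj] psubset.prems(1) by simp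
  finally show ?case using psubset.hyps(1) psubset.prems(1) by (cases "S = {}") auto
qed

lemma weight_UN:
  assumes "finite T" "\<And>i. i \<in> T \<Longrightarrow> finite (Z i)"
    "\<And>i j. i \<in> T \<Longrightarrow> j \<in> T \<Longrightarrow> i \<noteq> j \<Longrightarrow> unrelated R (Z i) (Z j)"
  shows "weight R (\<Union>i\<in>T. Z i) = (\<Prod>i\<in>T. weight R (Z i) :: 'k::field_char_0)"
  using assms
proof (induction T rule: finite_induct)
  case empty
  then show ?case by simp
next
  case (insert i T)
  have "unrelated R (Z i) (\<Union>j\<in>T. Z j)"
    using insert.prems(2)[of i] insert.hyps(2) unfolding unrelated_def by blast
  then have "weight R (\<Union>j\<in>insert i T. Z j) = weight R (Z i) * (weight R (\<Union>j\<in>T. Z j) :: 'k)"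
    by (intro weight_Un) (use insert.hyps(1) insert.prems(1) in auto)
  then show ?case using insert by simp
qed

definition upsets :: "('a \<Rightarrow> 'a \<Rightarrow> bool) \<Rightarrow> 'a set \<Rightarrow> 'a set set" where
  "upsets R S = {J. J \<subseteq> S \<and> (\<forall>b\<in>J. \<forall>b'\<in>S. R b b' \<longrightarrow> b' \<in> J)}"

lemma finite_upsets: "finite S \<Longrightarrow> finite (upsets R S)"
  by (rule finite_subset[of _ "Pow S"]) (auto simp: upsets_def)

text \<open>Induction on \<open>k\<close>, by removing a maximal element \<open>m\<close> of \<open>J\<close>. It is also maximal in \<open>S\<close>, and \<open>J - {m}\<close> is
an upset of \<open>S - {m}\<close> with the same complement, so both sides satisfy the recursion \<open>weight_rec\<close>.\<close>

lemma sum_weight_upsets: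
  assumes "finite S"
  shows "(\<Sum>J\<in>{J \<in> upsets R S. card J = k}. weight R (S - J) * weight R J) =
    of_nat (card S choose k) * (weight R S :: 'k::field_char_0)"
  using assms
proof (induction k arbitrary: S)
  case 0
  have "{J \<in> upsets R S. card J = 0} = {{}}"
  proof (intro set_eqI iffI)
    fix J assume "J \<in> {J \<in> upsets R S. card J = 0}"
    then show "J \<in> {{}}" using finite_subset[OF _ 0] by (auto simp: upsets_def)
  qed (simp add: upsets_def)
  then show ?case by simp
next
  case (Suc k)
  let ?w = "weight R :: 'a set \<Rightarrow> 'k"
  let ?U = "\<lambda>S k. {J \<in> upsets R S. card J = k}"
  have fin: "finite (?U S k)" if "finite S" for S k using finite_upsets[OF that] by simp
  have finJ: "finite J" if "J \<in> ?U S l" for J l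
    using that finite_subset[OF _ Suc.prems] by (auto simp: upsets_def)
  have "of_nat (Suc k) * (\<Sum>J\<in>?U S (Suc k). ?w (S - J) * ?w J) =
      (\<Sum>J\<in>?U S (Suc k). ?w (S - J) * (of_nat (card J) * ?w J))"
    unfolding sum_distrib_left by (rule sum.cong) (simp_all add: mult_ac)
  also have "\<dots> = (\<Sum>J\<in>?U S (Suc k). \<Sum>m\<in>maximals R J. ?w (S - J) * ?w (J - {m}))"
    using finJ by (intro sum.cong refl) (simp only: weight_rec sum_distrib_left)
  also have "\<dots> = (\<Sum>(J, m)\<in>(SIGMA J:?U S (Suc k). maximals R J). ?w (S - J) * ?w (J - {m}))"
    using finJ fin[OF Suc.prems] by (intro sum.Sigma) (auto intro: finite_maximals)
  also have "\<dots> = (\<Sum>(m, J)\<in>(SIGMA m:maximals R S. ?U (S - {m}) k). ?w (S - {m} - J) * ?w J)"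
  proof (rule sum.reindex_bij_witness[where j = "\<lambda>(J, m). (m, J - {m})" and i = "\<lambda>(m, J). (insert m J, m)"])
    fix a assume "a \<in> (SIGMA J:?U S (Suc k). maximals R J)"
    then obtain J m where a: "a = (J, m)" "J \<in> ?U S (Suc k)" "m \<in> maximals R J" by blast
    have m: "m \<in> J" using a(3) by (simp add: maximals_def)
    show "(case case a of (J, m) \<Rightarrow> (m, J - {m}) of (m, J) \<Rightarrow> (insert m J, m)) = a"
      using m by (auto simp: a(1))
    have "m \<in> maximals R S" using a(2,3) unfolding maximals_def upsets_def by blast
    moreover have "J - {m} \<in> upsets R (S - {m})" using a(2) unfolding upsets_def by blast
    moreover have "card (J - {m}) = k" using a(2) m finJ[OF a(2)] by simp
    ultimately show "(case a of (J, m) \<Rightarrow> (m, J - {m})) \<in> (SIGMA m:maximals R S. ?U (S - {m}) k)"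
      by (simp add: a(1))
    have "S - {m} - (J - {m}) = S - J" using m by blast
    then show "(case case a of (J, m) \<Rightarrow> (m, J - {m}) of (m, J) \<Rightarrow> ?w (S - {m} - J) * ?w J) =
        (case a of (J, m) \<Rightarrow> ?w (S - J) * ?w (J - {m}))"
      by (simp add: a(1))
  next
    fix a assume "a \<in> (SIGMA m:maximals R S. ?U (S - {m}) k)"
    then obtain J m where a: "a = (m, J)" "J \<in> ?U (S - {m}) k" "m \<in> maximals R S" by blast
    have m: "m \<in> S" "m \<notin> J" using a by (auto simp: maximals_def upsets_def)
    have finJ: "finite J" using a(2) finite_subset[of J S] Suc.prems by (auto simp: upsets_def)
    show "(case case a of (m, J) \<Rightarrow> (insert m J, m) of (J, m) \<Rightarrow> (m, J - {m})) = a"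
      using m by (auto simp: a(1))
    have "m \<in> maximals R (insert m J)" using a(2,3) unfolding maximals_def upsets_def by blast
    moreover have "insert m J \<in> upsets R S" using a(2,3) m unfolding maximals_def upsets_def by blast
    moreover have "card (insert m J) = Suc k" using a(2) m finJ by simp
    ultimately show "(case a of (m, J) \<Rightarrow> (insert m J, m)) \<in> (SIGMA J:?U S (Suc k). maximals R J)"
      by (simp add: a(1))
  qed
  also have "\<dots> = (\<Sum>m\<in>maximals R S. \<Sum>J\<in>?U (S - {m}) k. ?w (S - {m} - J) * ?w J)"
    using Suc.prems fin by (intro sum.Sigma[symmetric]) (auto intro: finite_maximals)
  also have "\<dots> = (\<Sum>m\<in>maximals R S. of_nat ((card S - 1) choose k) * ?w (S - {m}))"
  proof (rule sum.cong[OF refl])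
    fix m assume "m \<in> maximals R S"
    then have "card (S - {m}) = card S - 1" using Suc.prems by (simp add: maximals_def)
    then show "(\<Sum>J\<in>?U (S - {m}) k. ?w (S - {m} - J) * ?w J) = of_nat ((card S - 1) choose k) * ?w (S - {m})"
      using Suc.IH[of "S - {m}"] Suc.prems by simp
  qed
  also have "\<dots> = of_nat (((card S - 1) choose k) * card S) * ?w S"
    unfolding sum_distrib_left[symmetric] weight_rec[OF Suc.prems, symmetric] by (simp only: of_nat_mult mult.assoc)
  also have "((card S - 1) choose k) * card S = Suc k * (card S choose Suc k)"
  proof (cases "card S")
    case (Suc n)
    then show ?thesis using Suc_times_binomial[of k n] by (simp only: diff_Suc_1 mult.commute)
  qed simp
  finally have "of_nat (Suc k) * (\<Sum>J\<in>?U S (Suc k). ?w (S - J) * ?w J) =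
      of_nat (Suc k) * (of_nat (card S choose Suc k) * ?w S)"
    by (simp only: of_nat_mult mult.assoc)
  then show ?case by (simp only: mult_cancel_left of_nat_eq_0_iff) simp
qed

text \<open>For a chain this is the classical binomial theorem divided by \<open>|S|!\<close>.\<close>

lemma weight_binomial:
  fixes x y :: "'k::field_char_0"
  assumes S: "finite S"
  shows "(\<Sum>J\<in>upsets R S. (weight R (S - J) * x ^ card (S - J)) * (weight R J * y ^ card J)) =
    weight R S * (x + y) ^ card S"
proof -
  let ?N = "card S"
  have cards: "card (S - J) = ?N - card J" "card J \<le> ?N" if "J \<in> upsets R S" for J
    using that S by (auto simp: upsets_def card_Diff_subset finite_subset card_mono)
  have "(\<Sum>J\<in>upsets R S. (weight R (S - J) * x ^ card (S - J)) * (weight R J * y ^ card J)) =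
    (\<Sum>k\<le>?N. \<Sum>J\<in>{J \<in> upsets R S. card J = k}.
        (weight R (S - J) * x ^ card (S - J)) * (weight R J * y ^ card J))"
    by (rule sum.group[symmetric]) (use finite_upsets[OF S] cards in auto)
  also have "\<dots> = (\<Sum>k\<le>?N. (\<Sum>J\<in>{J \<in> upsets R S. card J = k}. weight R (S - J) * weight R J) *
      (x ^ (?N - k) * y ^ k))"
    unfolding sum_distrib_right by (intro sum.cong refl) (simp add: cards mult_ac)
  also have "\<dots> = weight R S * (\<Sum>k\<le>?N. of_nat (?N choose k) * y ^ k * x ^ (?N - k))"
    unfolding sum_weight_upsets[OF S] sum_distrib_left by (simp only: mult_ac)
  also have "\<dots> = weight R S * (x + y) ^ ?N"
    by (simp only: binomial_ring[of y x, symmetric] add.commute[of y x])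
  finally show ?thesis .
qed

section \<open>The homogeneous morphism\<close>

definition lam0 :: "ncp \<Rightarrow> 'k::field_char_0" where
  "lam0 \<pi> = of_nat (le \<pi>) / fact (card (blocks \<pi>))"

lemma lam0_eq_weight: "lam0 \<pi> = weight nest_le (blocks \<pi>)"
  by (simp add: lam0_def weight_def le_def linear_extensions_def lin_ext_def)

lemma nest_le_iff:
  assumes "finite b" "b \<noteq> {}"
  shows "nest_le b b' \<longleftrightarrow> (\<forall>y\<in>b'. (\<exists>x\<in>b. x \<le> y) \<and> (\<exists>z\<in>b. y \<le> z))"
  using Min_le_iff[OF assms] Max_ge_iff[OF assms] by (auto simp: nest_le_def)

lemma blocks_standard:
  assumes "Y \<subseteq> blocks \<pi>" "Y \<noteq> {}"
  shows "blocks (standard Y) = relabel (\<lambda>x. card {y \<in> \<Union>Y. y \<le> x}) Y"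
  using standardize_ncp[OF assms] by (simp add: standard_def standardize_eq_relabel)

lemma inj_on_relabel:
  fixes \<rho> :: "nat \<Rightarrow> nat"
  assumes "strict_mono_on (\<Union>Y) \<rho>"
  shows "inj_on (\<lambda>b. \<rho> ` b) Y"
  by (rule inj_on_subset[OF inj_on_image_Pow[OF strict_mono_on_imp_inj_on[OF assms]]]) blast

lemma card_blocks_standard:
  assumes "Y \<subseteq> blocks \<pi>" "Y \<noteq> {}"
  shows "card (blocks (standard Y)) = card Y"
  unfolding blocks_standard[OF assms] relabel_def
  by (rule card_image[OF inj_on_relabel[OF strict_mono_on_rank]])

lemma hat_lam0:
  assumes Y: "Y \<subseteq> blocks \<pi>"
  shows "hat lam0 Y = (weight nest_le Y :: 'k::field_char_0)"
proof (cases "Y = {}")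
  case True
  then show ?thesis by (simp add: hat_def)
next
  case False
  let ?\<rho> = "\<lambda>x. card {y \<in> \<Union>Y. y \<le> x}"
  have \<rho>: "strict_mono_on (\<Union>Y) ?\<rho>" by (rule strict_mono_on_rank)
  have "nest_le (?\<rho> ` b) (?\<rho> ` b') \<longleftrightarrow> nest_le b b'" if b: "b \<in> Y" "b' \<in> Y" for b b'
  proof -
    have "b \<in> blocks \<pi>" using b Y by blast
    then have fin: "finite b" "b \<noteq> {}" by (rule block_finite, rule block_nonempty)
    have le: "?\<rho> x \<le> ?\<rho> y \<longleftrightarrow> x \<le> y" if "x \<in> \<Union>Y" "y \<in> \<Union>Y" for x y
      by (rule strict_mono_on_less_eq[OF \<rho> that])
    have sub: "x \<in> \<Union>Y" if "x \<in> b \<or> x \<in> b'" for x using b that by blast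
    show ?thesis
      using fin sub by (simp add: nest_le_iff le del: Union_iff)
  qed
  then have "weight nest_le ((\<lambda>b. ?\<rho> ` b) ` Y) = (weight nest_le Y :: 'k)"
    using finite_subset[OF Y finite_blocks] inj_on_relabel[OF \<rho>] by (intro weight_image) auto
  then show ?thesis
    using False blocks_standard[OF Y False] by (simp add: hat_def lam0_eq_weight relabel_def)
qed

text \<open>The value at \<open>x\<close> of the homogeneous polynomial \<open>\<lambda>\<^sub>0(\<pi>) X\<^bsup>|\<pi>|\<^esup>\<close>.\<close>

definition lam0_scaled :: "'k \<Rightarrow> ncp \<Rightarrow> 'k::field_char_0" where
  "lam0_scaled x \<pi> = lam0 \<pi> * x ^ card (blocks \<pi>)"

lemma hat_lam0_scaled:
  fixes x :: "'k::field_char_0"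
  assumes Y: "Y \<subseteq> blocks \<pi>"
  shows "hat (lam0_scaled x) Y = weight nest_le Y * x ^ card Y"
proof (cases "Y = {}")
  case False
  have "hat lam0 Y = (weight nest_le Y :: 'k)" by (rule hat_lam0[OF Y])
  then show ?thesis using False card_blocks_standard[OF Y] by (simp add: hat_def lam0_scaled_def)
qed (simp add: hat_def)

lemma ideals_eq_upsets: "ideals \<pi> = upsets nest_le (blocks \<pi>)"
  by (simp add: ideals_def upsets_def)

text \<open>Blocks in different segments of an ideal are not nested, so the weights of the segments multiply to the
weight of the ideal, and the sum becomes that of the binomial theorem.\<close>

lemma conv_lam0_scaled:
  fixes x y :: "'k::field_char_0"
  shows "conv_fn (lam0_scaled x) (lam0_scaled y) = lam0_scaled (x + y)"
proof
  fix \<pi>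
  have "hat (lam0_scaled x) (blocks \<pi> - J) * (\<Prod>I\<in>segments (\<Union>J). hat (lam0_scaled y) {b \<in> J. b \<subseteq> I}) =
     (weight nest_le (blocks \<pi> - J) * x ^ card (blocks \<pi> - J)) * (weight nest_le J * y ^ card J)"
    if J: "J \<in> ideals \<pi>" for J
  proof -
    let ?S = "segments (\<Union>J)" and ?J = "\<lambda>I. {b \<in> J. b \<subseteq> I}"
    have JY: "J \<subseteq> blocks \<pi>" by (rule ideal_subset[OF J])
    have finJ: "finite J" using finite_subset[OF JY finite_blocks] .
    have finS: "finite ?S" by (rule finite_segments[OF finite_Union_blocks[OF JY]])
    have UN: "(\<Union>I\<in>?S. ?J I) = J" using ideal_block_in_segment[OF J] by blast
    have sub: "?J I \<subseteq> blocks \<pi>" for I using JY by blast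
    have un: "unrelated nest_le (?J I) (?J I')" if I: "I \<in> ?S" "I' \<in> ?S" "I \<noteq> I'" for I I'
    proof -
      \<comment> \<open>An inner block has a point between the end points of the outer one, hence in its segment.\<close>
      have key: "I = I'" if h: "b \<in> ?J I" "b' \<in> ?J I'" "nest_le b b'" "I \<in> ?S" "I' \<in> ?S" for I I' b b'
      proof -
        have bb: "b \<in> blocks \<pi>" "b' \<in> blocks \<pi>" using h(1,2) JY by blast+
        obtain x where x: "x \<in> b'" using block_nonempty[OF bb(2)] by blast
        have "Min b \<in> I" "Max b \<in> I"
          using Min_in[OF block_finite[OF bb(1)] block_nonempty[OF bb(1)]]
            Max_in[OF block_finite[OF bb(1)] block_nonempty[OF bb(1)]] h(1) by blast+
        moreover have "x \<in> {Min b..Max b}" using h(3) x unfolding nest_le_def by blast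
        ultimately have "x \<in> I" using segment_convex[OF h(4), of "Min b" "Max b" x] by simp
        moreover have "x \<in> I'" using x h(2) by blast
        ultimately show ?thesis by (rule segments_disjoint[OF h(4,5)])
      qed
      have "?J I \<inter> ?J I' = {}"
      proof (rule ccontr)
        assume "?J I \<inter> ?J I' \<noteq> {}"
        then obtain b where b: "b \<in> ?J I" "b \<in> ?J I'" by blast
        then obtain x where "x \<in> b" using block_nonempty[of b \<pi>] JY by blast
        then show False using segments_disjoint[OF I(1,2), of x] b I(3) by blast
      qed
      then show ?thesis unfolding unrelated_def using key[OF _ _ _ I(1,2)] key[OF _ _ _ I(2,1)] I(3) by metis
    qed
    have "weight nest_le (\<Union>I\<in>?S. ?J I) = (\<Prod>I\<in>?S. weight nest_le (?J I) :: 'k)"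
      by (rule weight_UN[OF finS]) (use finJ un in \<open>simp_all\<close>)
    then have "(\<Prod>I\<in>?S. weight nest_le (?J I) :: 'k) = weight nest_le J" unfolding UN ..
    moreover have "(\<Sum>I\<in>?S. card (?J I)) = card J"
      using card_UN_disjoint[OF finS, of ?J] finJ un UN by (simp add: unrelated_def)
    ultimately show ?thesis
      by (simp add: hat_lam0_scaled[OF sub] hat_lam0_scaled[OF Diff_subset] prod.distrib power_sum[symmetric])
  qed
  then have "conv_fn (lam0_scaled x) (lam0_scaled y) \<pi> = (\<Sum>J\<in>upsets nest_le (blocks \<pi>).
     (weight nest_le (blocks \<pi> - J) * x ^ card (blocks \<pi> - J)) * (weight nest_le J * y ^ card J))"
    unfolding conv_fn_def ideals_eq_upsets[symmetric] by (intro sum.cong refl)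
  then show "conv_fn (lam0_scaled x) (lam0_scaled y) \<pi> = lam0_scaled (x + y) \<pi>"
    by (simp add: weight_binomial lam0_scaled_def lam0_eq_weight)
qed

text \<open>Since blocks are disjoint, a block whose range is shortest among those of a set is maximal for nesting;
so linear extensions exist. This gives the degree of the polynomial.\<close>

lemma lam0_nonzero: "lam0 \<pi> \<noteq> (0 :: 'k::field_char_0)"
proof -
  have "maximals nest_le Z \<noteq> {}" if Z: "Z \<subseteq> blocks \<pi>" "Z \<noteq> {}" for Z
  proof -
    have fin: "finite Z" using finite_subset[OF Z(1) finite_blocks] .
    obtain b where b: "b \<in> Z" "\<And>b'. b' \<in> Z \<Longrightarrow> Max b - Min b \<le> Max b' - Min b'"
      using ex_min_if_finite[of "(\<lambda>b. Max b - Min b) ` Z"] fin Z(2) by (auto simp: not_less)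
    have "b \<in> maximals nest_le Z"
      unfolding maximals_def
    proof (intro CollectI conjI ballI impI b(1))
      fix b' assume h: "b' \<in> Z" "nest_le b b'"
      have bb: "b \<in> blocks \<pi>" "b' \<in> blocks \<pi>" using Z(1) b(1) h(1) by blast+
      note B = block_finite[OF bb(1)] block_nonempty[OF bb(1)]
      note B' = block_finite[OF bb(2)] block_nonempty[OF bb(2)]
      have "Min b' \<in> {Min b..Max b}" "Max b' \<in> {Min b..Max b}"
        using h(2) Min_in[OF B'] Max_in[OF B'] unfolding nest_le_def by blast+
      moreover have "Min b' \<le> Max b'" using Min_in[OF B'] Max_ge[OF B'(1)] by simp
      ultimately have "Min b' = Min b" using b(2)[OF h(1)] by simp
      then show "b' = b" using block_eq[OF bb(2,1) Min_in[OF B']] Min_in[OF B] by simp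
    qed
    then show ?thesis by blast
  qed
  then have "card (lin_ext nest_le (blocks \<pi>)) > 0" by (intro lin_ext_nonempty) auto
  then show ?thesis by (simp add: lam0_eq_weight weight_def)
qed

lemma lam0_single:
  assumes "card (blocks \<pi>) = 1"
  shows "lam0 \<pi> = (1 :: 'k::field_char_0)"
proof -
  obtain b where b: "blocks \<pi> = {b}" using assms by (auto simp: card_1_singleton_iff)
  have "maximals nest_le {b} = {b}" by (auto simp: maximals_def)
  moreover have "of_nat (card {b}) * weight nest_le {b} =
      (\<Sum>m\<in>maximals nest_le {b}. weight nest_le ({b} - {m}) :: 'k)"
    by (rule weight_rec) simp
  ultimately have "(weight nest_le {b} :: 'k) = 1" by simp
  then show ?thesis by (simp add: lam0_eq_weight b)
qed

section \<open>The double bialgebra morphism\<close>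

lemma star_fn_eq:
  "star_fn f g \<pi> = (\<Sum>P\<in>contractions (blocks \<pi>). f (standard (Union ` P)) * (\<Prod>C\<in>P. g (standard C)))"
  unfolding star_fn_def star_on_def
proof (rule sum.cong[OF refl])
  fix P assume P: "P \<in> contractions (blocks \<pi>)"
  have "P \<noteq> {}" using contractionD(1)[OF P] blocks_nonempty[of \<pi>] by (metis Union_empty)
  moreover have "(\<Prod>C\<in>P. hat g C) = (\<Prod>C\<in>P. g (standard C))"
    using contraction_class(1)[OF finite_blocks P] by (intro prod.cong refl) (simp add: hat_def)
  ultimately show "hat f (Union ` P) * (\<Prod>C\<in>P. hat g C) = f (standard (Union ` P)) * (\<Prod>C\<in>P. g (standard C))"
    by (simp add: hat_def)
qed

lemma card_blocks_quotient:
  assumes "P \<in> contractions (blocks \<pi>)"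
  shows "card (blocks (standard (Union ` P))) = card P"
proof -
  obtain q where "blocks q = Union ` P" using contraction_quotient[OF assms] by (elim exE)
  then show ?thesis using standard_blocks[of q] card_Union_image_contractions(2)[OF assms] by simp
qed

lemma card_blocks_class:
  assumes "P \<in> contractions (blocks \<pi>)" "C \<in> P"
  shows "card (blocks (standard C)) = card C"
  using contraction_class(1,2)[OF finite_blocks assms] by (intro card_blocks_standard)

definition eps_fn :: "ncp \<Rightarrow> 'k::field_char_0" where
  "eps_fn \<pi> = (if card (blocks \<pi>) = 1 then 1 else 0)"

lemma sum_contractions_one_class:
  assumes "\<And>P. P \<in> contractions (blocks \<pi>) \<Longrightarrow> card P \<noteq> 1 \<Longrightarrow> F P = 0"
  shows "(\<Sum>P\<in>contractions (blocks \<pi>). F P) = F {blocks \<pi>}"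
proof -
  have "(\<Sum>P\<in>contractions (blocks \<pi>). F P) = (\<Sum>P\<in>{{blocks \<pi>}}. F P)"
  proof (rule sum.mono_neutral_right)
    show "\<forall>P\<in>contractions (blocks \<pi>) - {{blocks \<pi>}}. F P = 0"
      using assms contraction_one_class by blast
  qed (use contraction_indiscrete in auto)
  then show ?thesis by simp
qed

text \<open>Only the total contraction has a quotient with a single block.\<close>

lemma star_fn_left_unit: "star_fn eps_fn h = h"
proof
  fix \<pi>
  have "star_fn eps_fn h \<pi> =
      eps_fn (standard (Union ` {blocks \<pi>})) * (\<Prod>C\<in>{blocks \<pi>}. h (standard C))"
    unfolding star_fn_eq by (rule sum_contractions_one_class) (simp add: eps_fn_def card_blocks_quotient)
  then show "star_fn eps_fn h \<pi> = h \<pi>"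
    using card_blocks_quotient[OF contraction_indiscrete[OF blocks_nonempty[of \<pi>]]]
    by (simp add: eps_fn_def standard_blocks)
qed

declare sum.cong [fundef_cong] prod.cong [fundef_cong]

text \<open>The right inverse of \<^const>\<open>lam0\<close> for \<^const>\<open>star_fn\<close>: the total contraction contributes
\<open>\<lambda>\<^sub>0(one block) \<lambda>(\<pi>) = \<lambda>(\<pi>)\<close> to \<open>(\<lambda>\<^sub>0 \<star> \<lambda>)(\<pi>)\<close>, and the other contractions involve \<open>\<lambda>\<close> only on smaller
partitions.\<close>

function lam :: "ncp \<Rightarrow> 'k::field_char_0" where
  "lam \<pi> = eps_fn \<pi> - (\<Sum>P\<in>contractions (blocks \<pi>) - {{blocks \<pi>}}.
     lam0 (standard (Union ` P)) * (\<Prod>C\<in>P. lam (standard C)))"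
  by auto
termination
proof (relation "measure (\<lambda>\<pi>. card (blocks \<pi>))")
  fix \<pi> P C assume P: "P \<in> contractions (blocks \<pi>) - {{blocks \<pi>}}" and C: "C \<in> P"
  then show "(standard C, \<pi>) \<in> measure (\<lambda>\<pi>. card (blocks \<pi>))"
    using card_blocks_class[of P \<pi> C] contraction_card_less[OF finite_blocks, of P \<pi> C] by simp
qed simp

declare lam.simps [simp del]

lemma lam0_one_block: "lam0 (standard {\<Union>(blocks \<pi>)}) = (1 :: 'k::field_char_0)"
  using card_blocks_quotient[OF contraction_indiscrete[OF blocks_nonempty[of \<pi>]]] by (intro lam0_single) simp

lemma star_lam0_split:
  "star_fn lam0 g \<pi> = g \<pi> + (\<Sum>P\<in>contractions (blocks \<pi>) - {{blocks \<pi>}}.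
     lam0 (standard (Union ` P)) * (\<Prod>C\<in>P. g (standard C)))"
  unfolding star_fn_eq using contraction_indiscrete[OF blocks_nonempty[of \<pi>]]
  by (subst sum.remove[of _ "{blocks \<pi>}"]) (simp_all add: lam0_one_block standard_blocks)

lemma star_lam0_lam: "star_fn lam0 lam = eps_fn"
proof
  show "star_fn lam0 lam \<pi> = eps_fn \<pi>" for \<pi>
    unfolding star_lam0_split by (subst lam.simps[of \<pi>]) simp
qed

lemma star_lam0_cancel:
  assumes eq: "star_fn lam0 g = star_fn lam0 g'"
  shows "g \<pi> = g' \<pi>"
proof (induction "card (blocks \<pi>)" arbitrary: \<pi> rule: less_induct)
  case less
  have "(\<Prod>C\<in>P. g (standard C)) = (\<Prod>C\<in>P. g' (standard C))"
    if P: "P \<in> contractions (blocks \<pi>) - {{blocks \<pi>}}" for P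
  proof (rule prod.cong[OF refl])
    fix C assume C: "C \<in> P"
    show "g (standard C) = g' (standard C)"
      using P C card_blocks_class[of P \<pi> C] contraction_card_less[OF finite_blocks, of P \<pi> C]
      by (intro less) simp
  qed
  then show "g \<pi> = g' \<pi>"
    using fun_cong[OF eq, of \<pi>] unfolding star_lam0_split by simp
qed

lemma lam_single:
  assumes "card (blocks \<pi>) = 1"
  shows "lam \<pi> = (1 :: 'k::field_char_0)"
proof -
  have "P = {blocks \<pi>}" if P: "P \<in> contractions (blocks \<pi>)" for P
  proof -
    have "P \<noteq> {}" using contractionD(1)[OF P] blocks_nonempty[of \<pi>] by (metis Union_empty)
    then have "card P = 1"
      using contraction_card_le[OF finite_blocks P] contraction_finite[OF finite_blocks P] assms
      by (simp add: le_Suc_eq)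
    then show ?thesis by (rule contraction_one_class[OF P])
  qed
  then have "contractions (blocks \<pi>) - {{blocks \<pi>}} = {}" by blast
  then show ?thesis by (simp only: lam.simps[of \<pi>] sum.empty) (simp add: eps_fn_def assms)
qed

text \<open>The right-hand side of the theorem.\<close>

definition ncp_poly :: "ncp \<Rightarrow> 'k::field_char_0 poly" where
  "ncp_poly \<pi> = (\<Sum>P\<in>contractions (blocks \<pi>).
     monom (lam0 (standard (Union ` P)) * (\<Prod>C\<in>P. lam (standard C))) (card P))"

abbreviation ncp_poly_at :: "'k::field_char_0 \<Rightarrow> ncp \<Rightarrow> 'k" where
  "ncp_poly_at x \<equiv> \<lambda>\<pi>. poly (ncp_poly \<pi>) x"

lemma ncp_poly_at_eq: "ncp_poly_at x = star_fn (lam0_scaled x) lam"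
proof
  fix \<pi>
  show "ncp_poly_at x \<pi> = star_fn (lam0_scaled x) lam \<pi>"
    unfolding star_fn_eq ncp_poly_def poly_sum
    by (rule sum.cong) (simp_all add: poly_monom lam0_scaled_def card_blocks_quotient)
qed

lemma ncp_poly_at_add: "ncp_poly_at (x + y) = conv_fn (ncp_poly_at x) (ncp_poly_at y)"
  unfolding ncp_poly_at_eq star_distributes_over_conv[symmetric] conv_lam0_scaled ..

lemma ncp_poly_at_0: "ncp_poly_at (0 :: 'k::field_char_0) = (\<lambda>\<pi>. 0)"
proof
  fix \<pi>
  have "lam0_scaled (0 :: 'k) \<pi> = 0" for \<pi>
    using card_blocks_pos[of \<pi>] by (simp add: lam0_scaled_def)
  then show "ncp_poly_at (0 :: 'k) \<pi> = 0"
    using fun_cong[OF ncp_poly_at_eq[of "0 :: 'k"], of \<pi>] by (simp add: star_fn_eq)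
qed

lemma ncp_poly_at_1: "ncp_poly_at (1 :: 'k::field_char_0) = eps_fn"
proof -
  have "lam0_scaled (1 :: 'k) = lam0" by (rule ext) (simp add: lam0_scaled_def)
  then show ?thesis unfolding ncp_poly_at_eq by (simp add: star_lam0_lam)
qed

text \<open>Repeated use of distributivity: \<open>p\<^bsub>n+1\<^esub> \<star> p\<^sub>y = (p\<^sub>n * p\<^sub>1) \<star> p\<^sub>y = (p\<^sub>n \<star> p\<^sub>y) * p\<^sub>y = p\<^bsub>ny\<^esub> * p\<^sub>y = p\<^bsub>ny+y\<^esub>\<close>,
as \<open>p\<^sub>1 = \<epsilon>\<^sub>\<delta>\<close> is a left unit.\<close>

lemma ncp_poly_at_mult:
  fixes y :: "'k::field_char_0"
  shows "star_fn (ncp_poly_at (of_nat n)) (ncp_poly_at y) = ncp_poly_at (of_nat n * y)"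
proof (induction n)
  case 0
  have "star_fn (\<lambda>\<pi>. 0) (ncp_poly_at y) = (\<lambda>\<pi>. 0)" by (rule ext) (simp add: star_fn_eq)
  then show ?case by (simp add: ncp_poly_at_0)
next
  case (Suc n)
  have "ncp_poly_at (of_nat (Suc n) :: 'k) = conv_fn (ncp_poly_at (of_nat n)) (ncp_poly_at 1)"
    using ncp_poly_at_add[of "of_nat n :: 'k" 1] by (simp add: add.commute)
  then have "star_fn (ncp_poly_at (of_nat (Suc n))) (ncp_poly_at y) =
      conv_fn (ncp_poly_at (of_nat n * y)) (ncp_poly_at y)"
    by (simp only: star_distributes_over_conv Suc.IH ncp_poly_at_1 star_fn_left_unit)
  also have "\<dots> = ncp_poly_at (of_nat (Suc n) * y)"
    by (simp add: ncp_poly_at_add[symmetric] algebra_simps)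
  finally show ?case .
qed

lemma poly_eqI_of_nat:
  fixes P Q :: "'a::{idom,ring_char_0} poly"
  assumes "\<And>n. poly P (of_nat n) = poly Q (of_nat n)"
  shows "P = Q"
proof (rule ccontr)
  assume "P \<noteq> Q"
  then have "finite {x. poly (P - Q) x = 0}" by (intro poly_roots_finite) simp
  moreover have "range of_nat \<subseteq> {x. poly (P - Q) x = 0}" using assms by auto
  ultimately have "finite (range (of_nat :: nat \<Rightarrow> 'a))" by (rule finite_subset[rotated])
  then show False using infinite_UNIV_char_0[where 'a = nat] finite_imageD[OF _ inj_of_nat] by blast
qed

text \<open>Here \<open>x\<close> is substituted for \<open>X \<otimes> 1\<close> and \<open>y\<close> for \<open>1 \<otimes> X\<close>.\<close>

definition eval2 :: "'k::field_char_0 \<Rightarrow> 'k \<Rightarrow> 'k poly poly \<Rightarrow> 'k" where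
  "eval2 x y Z = poly (poly Z [:y:]) x"

lemma eval2_hom: "eval2 x y (Z + Z') = eval2 x y Z + eval2 x y Z'"
  "eval2 x y (Z * Z') = eval2 x y Z * eval2 x y Z'" "eval2 x y [:[:c:]:] = c" "eval2 x y 0 = 0"
  by (simp_all add: eval2_def)

lemma eval2_sum: "eval2 x y (\<Sum>i\<in>I. Z i) = (\<Sum>i\<in>I. eval2 x y (Z i))"
  by (simp add: eval2_def poly_sum)

text \<open>The constant polynomials \<^term>\<open>of_nat m\<close> are infinitely many points of the domain \<open>'k poly\<close>, so values
at natural numbers determine a polynomial in two variables.\<close>

lemma eval2_eqI:
  assumes "\<And>n m. eval2 (of_nat n) (of_nat m) Z = eval2 (of_nat n) (of_nat m) Z'"
  shows "Z = Z'"
proof (rule poly_eqI_of_nat)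
  fix m
  show "poly Z (of_nat m) = poly Z' (of_nat m)"
    by (rule poly_eqI_of_nat) (use assms[of _ m] in \<open>simp add: eval2_def of_nat_poly\<close>)
qed

lemma eval2_poly_tensor: "eval2 x y (poly_tensor P Q) = poly P x * poly Q y"
proof -
  have "poly (map_poly (\<lambda>c. [:c:]) Q) [:y:] = [:poly Q y:]"
    by (induction Q) (simp_all add: map_poly_pCons)
  then show ?thesis by (simp add: eval2_def poly_tensor_def)
qed

lemma eval2_subst: "eval2 x y (poly (map_poly (\<lambda>c. [:[:c:]:]) P) Z) = poly P (eval2 x y Z)"
  by (induction P) (simp_all add: map_poly_pCons eval2_hom)

lemma eval2_Delta_poly: "eval2 x y (Delta_poly P) = poly P (x + y)"
  by (simp add: Delta_poly_def eval2_subst eval2_hom eval2_poly_tensor)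

lemma eval2_delta_poly: "eval2 x y (delta_poly P) = poly P (x * y)"
  by (simp add: delta_poly_def eval2_subst eval2_poly_tensor)

lemma eval2_tensor_map:
  "eval2 x y (tensor_map (\<lambda>c. [:[:c:]:]) poly_tensor \<phi> \<phi> z) =
     tensor_map (\<lambda>c. c) (*) (\<lambda>u. poly (\<phi> u) x) (\<lambda>u. poly (\<phi> u) y) z"
  unfolding tensor_map_def eval2_sum
  by (rule sum.cong[OF refl]) (simp only: split_def eval2_hom(2,3) eval2_poly_tensor)

definition ncp_morphism :: "'k::field_char_0 ncp_alg \<Rightarrow> 'k poly" where
  "ncp_morphism = alg_extend (\<lambda>c. [:c:]) ncp_poly"

lemma poly_ncp_morphism:
  fixes x :: "'k::field_char_0"
  shows "(\<lambda>u. poly (ncp_morphism u) x) = char_ext (ncp_poly_at x)"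
proof (rule alg_morphism_eqI)
  show "alg_morphism (Poly_Mapping.single 0) (\<lambda>c. c) (\<lambda>u. poly (ncp_morphism u) x)"
    using alg_extend_alg_morphism[OF structure_map_poly, of "ncp_poly :: ncp \<Rightarrow> 'k poly"]
    by (simp add: alg_morphism_def ncp_morphism_def)
  show "alg_morphism (Poly_Mapping.single 0) (\<lambda>c. c) (char_ext (ncp_poly_at x))"
    by (rule alg_extend_alg_morphism[OF structure_map_id])
qed (simp add: alg_extend_gen structure_map_id structure_map_poly ncp_morphism_def)

lemma eps_delta_eq: "eps_delta = char_ext eps_fn"
  by (simp add: eps_delta_def eps_fn_def[abs_def])

lemma ncp_morphism_double_bialgebra_morphism:
  "double_bialgebra_morphism (ncp_morphism :: 'k::field_char_0 ncp_alg \<Rightarrow> 'k poly)"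
  unfolding double_bialgebra_morphism_def
proof (intro conjI allI)
  show "alg_morphism (Poly_Mapping.single 0) (\<lambda>c. [:c:]) (ncp_morphism :: 'k ncp_alg \<Rightarrow> 'k poly)"
    unfolding ncp_morphism_def by (rule alg_extend_alg_morphism[OF structure_map_poly])
  fix z :: "'k ncp_alg"
  show "Delta_poly (ncp_morphism z) =
      tensor_map (\<lambda>c. [:[:c:]:]) poly_tensor ncp_morphism ncp_morphism (Delta z)"
    by (rule eval2_eqI) (simp add: eval2_Delta_poly eval2_tensor_map poly_ncp_morphism
        fun_cong[OF poly_ncp_morphism] conv_char_ext ncp_poly_at_add)
  show "delta_poly (ncp_morphism z) =
      tensor_map (\<lambda>c. [:[:c:]:]) poly_tensor ncp_morphism ncp_morphism (delta z)"
    by (rule eval2_eqI) (simp add: eval2_delta_poly eval2_tensor_map poly_ncp_morphism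
        fun_cong[OF poly_ncp_morphism] star_def[symmetric] star_char_ext ncp_poly_at_mult)
  show "poly (ncp_morphism z) 0 = eps_Delta z"
    by (simp add: fun_cong[OF poly_ncp_morphism] ncp_poly_at_0 eps_Delta_def)
  show "poly (ncp_morphism z) 1 = eps_delta z"
    by (simp add: fun_cong[OF poly_ncp_morphism] ncp_poly_at_1 eps_delta_eq)
qed

text \<open>Compatibility with \<^const>\<open>Delta\<close>, evaluated at \<open>(n, 1)\<close>, expresses the values at \<open>n + 1\<close> through those
at \<open>n\<close> and at \<open>1\<close>; the counits fix the values at \<open>0\<close> and at \<open>1\<close>.\<close>

lemma double_bialgebra_morphism_unique:
  fixes \<phi> \<psi> :: "'k::field_char_0 ncp_alg \<Rightarrow> 'k poly"
  assumes \<phi>: "double_bialgebra_morphism \<phi>" and \<psi>: "double_bialgebra_morphism \<psi>"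
  shows "\<phi> = \<psi>"
proof
  fix x
  have step: "(\<lambda>x. poly (\<phi> x) (of_nat (Suc n))) =
      (\<lambda>x. tensor_map (\<lambda>c. c) (*) (\<lambda>u. poly (\<phi> u) (of_nat n)) eps_delta (Delta x))"
    if "double_bialgebra_morphism \<phi>" for \<phi> :: "'k ncp_alg \<Rightarrow> 'k poly" and n
  proof
    fix x
    have h: "Delta_poly (\<phi> x) = tensor_map (\<lambda>c. [:[:c:]:]) poly_tensor \<phi> \<phi> (Delta x)"
      "(\<lambda>x. poly (\<phi> x) 1) = eps_delta"
      using that by (auto simp: double_bialgebra_morphism_def)
    have "poly (\<phi> x) (of_nat (Suc n)) = eval2 (of_nat n) 1 (Delta_poly (\<phi> x))"
      by (simp add: eval2_Delta_poly add.commute)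
    then show "poly (\<phi> x) (of_nat (Suc n)) =
        tensor_map (\<lambda>c. c) (*) (\<lambda>u. poly (\<phi> u) (of_nat n)) eps_delta (Delta x)"
      unfolding h(1) eval2_tensor_map h(2) .
  qed
  have "(\<lambda>x. poly (\<phi> x) (of_nat n)) = (\<lambda>x. poly (\<psi> x) (of_nat n))" for n
  proof (induction n)
    case 0
    then show ?case using \<phi> \<psi> by (simp add: double_bialgebra_morphism_def)
  next
    case (Suc n)
    then show ?case by (simp only: step[OF \<phi>] step[OF \<psi>])
  qed
  then show "\<phi> x = \<psi> x" by (intro poly_eqI_of_nat) (rule fun_cong)
qed

lemma phi_NCP_eq: "phi_NCP = ncp_morphism"
  unfolding phi_NCP_def
  using ncp_morphism_double_bialgebra_morphism double_bialgebra_morphism_unique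
  by (intro the_equality)

lemma phi_NCP_gen: "phi_NCP (gen \<pi>) = ncp_poly \<pi>"
  by (simp add: phi_NCP_eq ncp_morphism_def alg_extend_gen structure_map_poly)

section \<open>Coefficients\<close>

lemma coeff_ncp_poly_1: "coeff (ncp_poly \<pi>) 1 = (lam \<pi> :: 'k::field_char_0)"
proof -
  have "coeff (ncp_poly \<pi>) 1 = (\<Sum>P\<in>contractions (blocks \<pi>).
     if card P = 1 then lam0 (standard (Union ` P)) * (\<Prod>C\<in>P. lam (standard C) :: 'k) else 0)"
    by (simp add: ncp_poly_def coeff_sum)
  also have "\<dots> = lam \<pi>"
    by (subst sum_contractions_one_class) (simp_all add: lam0_one_block standard_blocks)
  finally show ?thesis .
qed

lemma coeff_ncp_poly_top: "coeff (ncp_poly \<pi>) (card (blocks \<pi>)) = (lam0 \<pi> :: 'k::field_char_0)"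
proof -
  let ?D = "{{b} | b. b \<in> blocks \<pi>}" and ?Y = "blocks \<pi>"
  let ?c = "\<lambda>P. lam0 (standard (Union ` P)) * (\<Prod>C\<in>P. lam (standard C) :: 'k)"
  have D: "?D \<in> contractions ?Y" by (rule contraction_discrete)
  have "?D = (\<lambda>b. {b}) ` ?Y" by blast
  then have cardD: "card ?D = card ?Y" and UD: "Union ` ?D = ?Y"
    by (simp_all add: card_image image_image)
  have "coeff (ncp_poly \<pi>) (card ?Y) = (\<Sum>P\<in>contractions ?Y. if card P = card ?Y then ?c P else 0)"
    by (simp add: ncp_poly_def coeff_sum)
  also have "\<dots> = (\<Sum>P\<in>{?D}. if card P = card ?Y then ?c P else 0)"
  proof (rule sum.mono_neutral_right)
    show "\<forall>P\<in>contractions ?Y - {?D}. (if card P = card ?Y then ?c P else 0) = 0"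
      using contraction_card_eq[OF finite_blocks, of _ \<pi>] by auto
  qed (use D in simp_all)
  also have "\<dots> = ?c ?D" using cardD by simp
  also have "\<dots> = lam0 \<pi>"
  proof -
    have "(\<Prod>C\<in>?D. lam (standard C) :: 'k) = (\<Prod>C\<in>?D. 1)"
    proof (rule prod.cong[OF refl])
      fix C assume C: "C \<in> ?D"
      then have "card C = 1" by auto
      then show "lam (standard C) = (1 :: 'k)" using card_blocks_class[OF D C] by (simp add: lam_single)
    qed
    then show ?thesis by (simp only: UD standard_blocks) simp
  qed
  finally show ?thesis .
qed

lemma degree_ncp_poly: "degree (ncp_poly \<pi> :: 'k::field_char_0 poly) = card (blocks \<pi>)"
proof (rule antisym)
  show "degree (ncp_poly \<pi> :: 'k poly) \<le> card (blocks \<pi>)"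
    unfolding ncp_poly_def
    by (intro degree_sum_le order.trans[OF degree_monom_le] contraction_card_le) simp_all
  show "card (blocks \<pi>) \<le> degree (ncp_poly \<pi> :: 'k poly)"
    by (rule le_degree) (simp add: coeff_ncp_poly_top lam0_nonzero)
qed

text \<open>The degrees of the factors are the sizes of the classes and add up to \<open>|\<pi>|\<close>, so this is the product of
the leading coefficients.\<close>

lemma coeff_prod_ncp_poly:
  assumes P: "P \<in> contractions (blocks \<pi>)"
  shows "coeff (\<Prod>C\<in>P. ncp_poly (standard C)) (card (blocks \<pi>)) =
    (\<Prod>C\<in>P. lam0 (standard C) :: 'k::field_char_0)"
proof -
  have nz: "ncp_poly \<rho> \<noteq> (0 :: 'k poly)" for \<rho>
  proof
    assume "ncp_poly \<rho> = (0 :: 'k poly)"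
    then have "lam0 \<rho> = (0 :: 'k)" by (simp flip: coeff_ncp_poly_top)
    then show False using lam0_nonzero by blast
  qed
  have "degree (\<Prod>C\<in>P. ncp_poly (standard C) :: 'k poly) = (\<Sum>C\<in>P. card C)"
    by (simp add: degree_prod_eq_sum_degree nz degree_ncp_poly card_blocks_class[OF P])
  also have "\<dots> = card (blocks \<pi>)" by (rule contraction_sum_card[OF finite_blocks P])
  finally have "coeff (\<Prod>C\<in>P. ncp_poly (standard C) :: 'k poly) (card (blocks \<pi>)) =
      lead_coeff (\<Prod>C\<in>P. ncp_poly (standard C) :: 'k poly)" by simp
  also have "\<dots> = (\<Prod>C\<in>P. lam0 (standard C))"
    by (simp add: lead_coeff_prod degree_ncp_poly coeff_ncp_poly_top)
  finally show ?thesis .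
qed

text \<open>Compare coefficients in the identity \<open>p\<^bsub>nm\<^esub> = p\<^sub>n \<star> p\<^sub>m\<close>, first of \<open>m\<^bsup>|\<pi>|\<^esup>\<close> for fixed \<open>n\<close>, which gives
\<open>\<lambda>\<^sub>0(\<pi>) n\<^bsup>|\<pi>|\<^esup> = (p\<^sub>n \<star> \<lambda>\<^sub>0)(\<pi>)\<close>, and then of \<open>n\<close>. The left side contributes only if \<open>|\<pi>| = 1\<close>.\<close>

lemma star_lam_lam0: "star_fn lam lam0 = (eps_fn :: ncp \<Rightarrow> 'k::field_char_0)"
proof
  fix \<pi>
  let ?N = "card (blocks \<pi>)" and ?p = "ncp_poly \<pi> :: 'k poly"
  \<comment> \<open>The identity \<open>p\<^bsub>nm\<^esub> = p\<^sub>n \<star> p\<^sub>m\<close> as an identity of polynomials in \<open>m\<close>.\<close>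
  have compose: "pcompose ?p [:0, of_nat n:] =
      (\<Sum>P\<in>contractions (blocks \<pi>). smult (poly (ncp_poly (standard (Union ` P))) (of_nat n))
          (\<Prod>C\<in>P. ncp_poly (standard C)))" for n
  proof (rule poly_eqI_of_nat)
    fix m
    show "poly (pcompose ?p [:0, of_nat n:]) (of_nat m) =
      poly (\<Sum>P\<in>contractions (blocks \<pi>). smult (poly (ncp_poly (standard (Union ` P))) (of_nat n))
          (\<Prod>C\<in>P. ncp_poly (standard C))) (of_nat m)"
      using fun_cong[OF ncp_poly_at_mult[of n "of_nat m :: 'k"], of \<pi>]
      by (simp add: poly_pcompose poly_sum poly_prod star_fn_eq mult.commute)
  qed
  have "monom (lam0 \<pi> :: 'k) ?N =
      (\<Sum>P\<in>contractions (blocks \<pi>). smult (\<Prod>C\<in>P. lam0 (standard C)) (ncp_poly (standard (Union ` P))))"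
  proof (rule poly_eqI_of_nat)
    fix n
    have "of_nat n ^ ?N * lam0 \<pi> = coeff (pcompose ?p [:0, of_nat n:]) ?N"
      by (simp add: coeff_pcompose_linear coeff_ncp_poly_top)
    also have "\<dots> = (\<Sum>P\<in>contractions (blocks \<pi>). poly (ncp_poly (standard (Union ` P))) (of_nat n) *
        (\<Prod>C\<in>P. lam0 (standard C)))"
      unfolding compose coeff_sum by (rule sum.cong) (simp_all add: coeff_prod_ncp_poly)
    finally show "poly (monom (lam0 \<pi> :: 'k) ?N) (of_nat n) = poly (\<Sum>P\<in>contractions (blocks \<pi>).
        smult (\<Prod>C\<in>P. lam0 (standard C)) (ncp_poly (standard (Union ` P)))) (of_nat n)"
      by (simp add: poly_monom poly_sum mult.commute)
  qed
  then have "coeff (monom (lam0 \<pi> :: 'k) ?N) 1 = (\<Sum>P\<in>contractions (blocks \<pi>).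
      (\<Prod>C\<in>P. lam0 (standard C)) * lam (standard (Union ` P)))"
    by (simp only: coeff_sum coeff_smult coeff_ncp_poly_1)
  then show "star_fn lam lam0 \<pi> = (eps_fn \<pi> :: 'k)"
    by (auto simp: star_fn_eq eps_fn_def lam0_single mult.commute)
qed

lemma lambda_0_eq: "lambda_0 = char_ext lam0"
  by (simp add: lambda_0_def lam0_def[abs_def])

text \<open>Existence of the inverse is \<open>star_lam0_lam\<close> with \<open>star_lam_lam0\<close>; its uniqueness is
the cancellation law \<open>star_lam0_cancel\<close>.\<close>

lemma lambda_NCP_eq: "lambda_NCP = (char_ext lam :: 'k::field_char_0 ncp_alg \<Rightarrow> 'k)"
  unfolding lambda_NCP_def
proof (rule the_equality)
  show "character (char_ext lam :: 'k ncp_alg \<Rightarrow> 'k) \<and> star lambda_0 (char_ext lam) = (eps_delta :: 'k ncp_alg \<Rightarrow> 'k) \<and>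
      star (char_ext lam) lambda_0 = (eps_delta :: 'k ncp_alg \<Rightarrow> 'k)"
    by (simp add: character_char_ext lambda_0_eq star_char_ext star_lam0_lam star_lam_lam0 eps_delta_eq)
  fix \<mu> :: "'k ncp_alg \<Rightarrow> 'k"
  assume \<mu>: "character \<mu> \<and> star lambda_0 \<mu> = eps_delta \<and> star \<mu> lambda_0 = eps_delta"
  define g where "g \<pi> = \<mu> (gen \<pi>)" for \<pi>
  have \<mu>g: "\<mu> = char_ext g" using character_eq_char_ext \<mu> unfolding g_def by blast
  have "star_fn lam0 g \<pi> = star_fn lam0 lam \<pi>" for \<pi>
  proof -
    have "star lambda_0 \<mu> (gen \<pi>) = eps_delta (gen \<pi>)" using \<mu> by simp
    then show ?thesis
      by (simp add: \<mu>g lambda_0_eq star_char_ext char_ext_gen star_lam0_lam eps_delta_eq)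
  qed
  then have "star_fn lam0 g = star_fn lam0 lam" by (rule ext)
  then have "g \<pi> = lam \<pi>" for \<pi> by (rule star_lam0_cancel)
  then have "g = lam" by (rule ext)
  then show "\<mu> = char_ext lam" unfolding \<mu>g by simp
qed

theorem corollary4p5:
  fixes \<pi> :: ncp
  shows
    "(phi_NCP (gen \<pi>) :: 'k::field_char_0 poly) =
       (\<Sum>r\<in>Ec \<pi>. monom (lambda_NCP (restr_equiv \<pi> r) *
          (of_nat (le (quotient_ncp \<pi> r)) / fact (cl \<pi> r))) (cl \<pi> r)) \<and>
     Polynomial.degree (phi_NCP (gen \<pi>) :: 'k poly) = card (blocks \<pi>) \<and>
     (lambda_NCP (gen \<pi>) :: 'k) = coeff (phi_NCP (gen \<pi>)) 1 \<and>
     (lambda_0 (gen \<pi>) :: 'k) = coeff (phi_NCP (gen \<pi>)) (card (blocks \<pi>))"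
proof (intro conjI)
  have "ncp_poly \<pi> = (\<Sum>r\<in>Ec \<pi>. let P = blocks \<pi> // r in
     monom (lam0 (standard (Union ` P)) * (\<Prod>C\<in>P. lam (standard C)) :: 'k) (card P))"
    unfolding ncp_poly_def Let_def by (rule sum_Ec_eq_sum_contractions[symmetric])
  also have "\<dots> = (\<Sum>r\<in>Ec \<pi>. monom (lambda_NCP (restr_equiv \<pi> r) *
          (of_nat (le (quotient_ncp \<pi> r)) / fact (cl \<pi> r))) (cl \<pi> r))"
  proof (rule sum.cong[OF refl])
    fix r assume r: "r \<in> Ec \<pi>"
    have P: "blocks \<pi> // r \<in> contractions (blocks \<pi>)"
      using r partition_on_quotient by (auto simp: Ec_def contractions_def merge_def)
    have q: "standard (Union ` (blocks \<pi> // r)) = quotient_ncp \<pi> r"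
      using merge_ncp[OF r] standard_blocks[of "quotient_ncp \<pi> r"] by (simp add: merge_def)
    have "lambda_NCP (restr_equiv \<pi> r) = (\<Prod>C\<in>blocks \<pi> // r. lam (standard C) :: 'k)"
      unfolding lambda_NCP_eq restr_equiv_def char_ext_prod char_ext_restr
      using contraction_class(1)[OF finite_blocks P] by (intro prod.cong refl) (simp add: hat_def)
    moreover have "lam0 (quotient_ncp \<pi> r) = (of_nat (le (quotient_ncp \<pi> r)) / fact (cl \<pi> r) :: 'k)"
      using card_blocks_quotient[OF P] by (simp add: lam0_def q cl_def)
    ultimately show "(let P = blocks \<pi> // r in
        monom (lam0 (standard (Union ` P)) * (\<Prod>C\<in>P. lam (standard C)) :: 'k) (card P)) =
      monom (lambda_NCP (restr_equiv \<pi> r) *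
          (of_nat (le (quotient_ncp \<pi> r)) / fact (cl \<pi> r))) (cl \<pi> r)"
      by (simp add: Let_def q cl_def mult.commute)
  qed
  finally show "(phi_NCP (gen \<pi>) :: 'k poly) = (\<Sum>r\<in>Ec \<pi>. monom (lambda_NCP (restr_equiv \<pi> r) *
          (of_nat (le (quotient_ncp \<pi> r)) / fact (cl \<pi> r))) (cl \<pi> r))"
    unfolding phi_NCP_gen .
  show "Polynomial.degree (phi_NCP (gen \<pi>) :: 'k poly) = card (blocks \<pi>)"
    unfolding phi_NCP_gen by (rule degree_ncp_poly)
  show "(lambda_NCP (gen \<pi>) :: 'k) = coeff (phi_NCP (gen \<pi>)) 1"
    unfolding phi_NCP_gen lambda_NCP_eq char_ext_gen coeff_ncp_poly_1 ..
  show "(lambda_0 (gen \<pi>) :: 'k) = coeff (phi_NCP (gen \<pi>)) (card (blocks \<pi>))"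
    unfolding phi_NCP_gen lambda_0_eq char_ext_gen coeff_ncp_poly_top ..
qed

end
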